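(* Let $R$ be a finite commutative ring with identity and $P$ a proper prime ideal of $R$ with $|P|\geq 2$; let $I=I(\Gamma_P(R))\subseteq S=k[x_1,\ldots,x_a,y_1,\ldots,y_b]$ be the edge ideal of the prime ideal graph, where $a=|P|-1$ and $b=|P|(|R/P|-1)$. Then the analytic spread of $I$ is $$\ell(I)=\begin{cases} b, & a=1,\\ a+b, & a\geq 2.\end{cases}$$ Equivalently, $$\ell(I)=\begin{cases}|R|-2, & |P|=2,\\ |R|-1, & |P|\geq 3.\end{cases}$$ Since $|R|=|P||R/P|$, this can also be written as $$\ell(I)=\begin{cases}2(|R/P|-1), & |P|=2,\\ |P||R/P|-1, & |P|\geq 3.\end{cases}$$
   Context: The prime ideal graph $\Gamma_P(R)$ is the simple graph with vertex set $R\setminus\{0\}$ in which two distinct vertices $x,y$ are adjacent if and only if $xy\in P$. Put $a=|P|-1$ and $b=|P|(|R/P|-1)=|R\setminus P|$. Write $P\setminus\{0\}=\{u_1,\ldots,u_a\}$, $R\setminus P=\{v_1,\ldots,v_b\}$; attach the variable $x_i$ to $u_i$ and $y_\ell$ to $v_\ell$. Let $k$ be a field and $S=k[x_1,\ldots,x_a,y_1,\ldots,y_b]$ with homogeneous maximal ideal $\mathfrak m=(x_1,\ldots,x_a,y_1,\ldots,y_b)$. The edge ideal $I=I(\Gamma_P(R))$ is the ideal of $S$ generated by the products of the two variables attached to the endpoints of each edge; explicitly $I=(x_ix_j,\;x_iy_\ell \mid 1\leq i<j\leq a,\;1\leq i\leq a,\;1\leq \ell\leq b)$. The special fiber ring is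 $\mathcal{F}(I)=\bigoplus_{n\geq 0}I^n/\mathfrak m I^n$, and the analytic spread $\ell(I)$ is the Krull dimension of $\mathcal{F}(I)$. *)

theory Defs
  imports
    "HOL-Algebra.Algebra"
    "HOL-Library.Poly_Mapping"
    "HOL-Library.Extended_Nat"
begin

section \<open>Prime ideal graphs\<close>

definition prime_ideal_graph_verts :: "('r, 'm) ring_scheme \<Rightarrow> 'r set"
  where "prime_ideal_graph_verts R = carrier R - {\<zero>\<^bsub>R\<^esub>}"

text \<open>An edge is a two-element set of vertices.\<close>

definition prime_ideal_graph_edges :: "('r, 'm) ring_scheme \<Rightarrow> 'r set \<Rightarrow> 'r set set"
  where "prime_ideal_graph_edges R P =
    {{x, y} | x y. x \<in> prime_ideal_graph_verts R \<and> y \<in> prime_ideal_graph_verts R \<and>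
                   x \<noteq> y \<and> x \<otimes>\<^bsub>R\<^esub> y \<in> P}"


section \<open>Polynomial rings and edge ideals\<close>

text \<open>The coefficient field is a type of class \<open>field\<close>.  The ring operations are those of the
  type of polynomials in all variables of type \<open>'v\<close>; the carrier consists of the polynomials
  involving only variables from \<open>V\<close>.\<close>

type_synonym ('v, 'k) mpolynomial = "('v \<Rightarrow>\<^sub>0 nat) \<Rightarrow>\<^sub>0 'k"

definition mpoly_ring :: "'v set \<Rightarrow> ('v, 'k::field) mpolynomial ring"
  where "mpoly_ring V =
    \<lparr>carrier = {p. \<forall>t\<in>Poly_Mapping.keys p. Poly_Mapping.keys t \<subseteq> V},
     monoid.mult = (*), one = 1, ring.zero = 0, add = (+)\<rparr>"

definition mvar :: "'v \<Rightarrow> ('v, 'k::field) mpolynomial"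
  where "mvar v = Poly_Mapping.single (Poly_Mapping.single v 1) 1"

definition homogeneous_max_ideal :: "'v set \<Rightarrow> ('v, 'k::field) mpolynomial set"
  where "homogeneous_max_ideal V = Idl\<^bsub>mpoly_ring V\<^esub> (mvar ` V)"

definition edge_ideal :: "'v set \<Rightarrow> 'v set set \<Rightarrow> ('v, 'k::field) mpolynomial set"
  where "edge_ideal V E = Idl\<^bsub>mpoly_ring V\<^esub> {mvar u * mvar v | u v. {u, v} \<in> E}"

lemma cring_mpoly_ring: "cring (mpoly_ring V :: ('v, 'k::field) mpolynomial ring)"
proof -
  have keys_uminus: "Poly_Mapping.keys (- p) = Poly_Mapping.keys p" for p :: "('v, 'k) mpolynomial"
    by (transfer) auto
  have mult: "p * q \<in> carrier (mpoly_ring V)"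
    if p: "p \<in> carrier (mpoly_ring V)" and q: "q \<in> carrier (mpoly_ring V)"
    for p q :: "('v, 'k) mpolynomial"
  proof -
    have "Poly_Mapping.keys t \<subseteq> V" if "t \<in> Poly_Mapping.keys (p * q)" for t
    proof -
      obtain r s where "t = r + s" "r \<in> Poly_Mapping.keys p" "s \<in> Poly_Mapping.keys q"
        using \<open>t \<in> Poly_Mapping.keys (p * q)\<close> keys_mult[of p q] by blast
      moreover have "Poly_Mapping.keys (r + s) \<subseteq> Poly_Mapping.keys r \<union> Poly_Mapping.keys s"
        by (rule Poly_Mapping.keys_add)
      ultimately show ?thesis
        using p q unfolding mpoly_ring_def by auto
    qed
    then show ?thesis by (simp add: mpoly_ring_def)
  qed
  have add: "p + q \<in> carrier (mpoly_ring V)"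
    if "p \<in> carrier (mpoly_ring V)" "q \<in> carrier (mpoly_ring V)"
    for p q :: "('v, 'k) mpolynomial"
    using that Poly_Mapping.keys_add[of p q] unfolding mpoly_ring_def by auto
  have neg: "- p \<in> carrier (mpoly_ring V)" if "p \<in> carrier (mpoly_ring V)"
    for p :: "('v, 'k) mpolynomial"
    using that by (simp add: mpoly_ring_def keys_uminus)
  have zero_one: "0 \<in> carrier (mpoly_ring V)" "1 \<in> carrier (mpoly_ring V)"
    by (simp_all add: mpoly_ring_def)
  have ops: "monoid.mult (mpoly_ring V) = (*)" "add (mpoly_ring V) = (+)"
    "\<one>\<^bsub>mpoly_ring V\<^esub> = 1" "\<zero>\<^bsub>mpoly_ring V\<^esub> = 0"
    by (simp_all add: mpoly_ring_def)
  show ?thesis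
  proof (intro cringI abelian_groupI comm_monoidI)
    fix p :: "('v, 'k) mpolynomial"
    assume "p \<in> carrier (mpoly_ring V)"
    then show "\<exists>q\<in>carrier (mpoly_ring V). q \<oplus>\<^bsub>mpoly_ring V\<^esub> p = \<zero>\<^bsub>mpoly_ring V\<^esub>"
      using neg by (intro bexI[of _ "- p"]) (simp_all add: ops)
  qed (simp_all add: ops mult add zero_one algebra_simps)
qed


section \<open>Krull dimension\<close>

text \<open>The supremum of the lengths \<open>n\<close> of chains \<open>C 0 \<subset> \<dots> \<subset> C n\<close> of prime ideals.  The zero ring,
  which has no prime ideals, gets dimension \<open>0\<close>.\<close>

definition krull_dim :: "('a, 'm) ring_scheme \<Rightarrow> enat"
  where "krull_dim A =
    Sup {enat n | n. \<exists>C :: nat \<Rightarrow> 'a set.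
           (\<forall>i\<le>n. primeideal (C i) A) \<and> (\<forall>i<n. C i \<subset> C (Suc i))}"


section \<open>Special fiber ring and analytic spread\<close>

text \<open>\<open>I\<^sup>n\<close>, as a power in the multiplicative monoid of ideals; in particular \<open>I\<^sup>0 = S\<close>.\<close>

definition ideal_pow :: "('a, 'm) ring_scheme \<Rightarrow> 'a set \<Rightarrow> nat \<Rightarrow> 'a set"
  where "ideal_pow S I n = I [^]\<^bsub>ideals_set S\<^esub> n"

text \<open>The ideal \<open>\<mm> I\<^sup>n\<close>, by whose cosets the degree \<open>n\<close> piece is formed.\<close>

definition fiber_den :: "('a, 'm) ring_scheme \<Rightarrow> 'a set \<Rightarrow> 'a set \<Rightarrow> nat \<Rightarrow> 'a set"
  where "fiber_den S \<mm> I n = ideal_prod S \<mm> (ideal_pow S I n)"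

lemma ideal_ideal_pow:
  assumes "cring S" "ideal I S"
  shows "ideal (ideal_pow S I n) S"
proof -
  interpret cring S by fact
  show ?thesis
    by (induction n)
       (use assms oneideal ideal_prod_is_ideal in
         \<open>auto simp: ideal_pow_def nat_pow_def ideals_set_def\<close>)
qed

lemma ideal_pow_mult:
  assumes "cring S" "ideal I S"
  shows "ideal_prod S (ideal_pow S I i) (ideal_pow S I j) = ideal_pow S I (i + j)"
proof -
  interpret cring S by fact
  have Suc: "ideal_pow S I (Suc n) = ideal_prod S (ideal_pow S I n) I" for n
    by (simp add: ideal_pow_def ideals_set_def)
  have "ideal_pow S I 0 = carrier S"
    by (simp add: ideal_pow_def ideals_set_def)
  then show ?thesis
    using assms ideal_ideal_pow[OF assms]
    by (induction j) (auto simp: Suc ideal_prod_one ideal_prod_assoc[symmetric])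
qed

text \<open>The product \<open>I\<^sup>i / \<mm> I\<^sup>i \<times> I\<^sup>j / \<mm> I\<^sup>j \<rightarrow> I\<^sup>i\<^sup>+\<^sup>j / \<mm> I\<^sup>i\<^sup>+\<^sup>j\<close> is well defined.\<close>

lemma rcoset_mult_fiber_den:
  assumes "cring S" "ideal \<mm> S" "ideal I S"
    and x: "x \<in> ideal_pow S I i" and y: "y \<in> ideal_pow S I j"
  shows "rcoset_mult S (fiber_den S \<mm> I (i + j))
           (fiber_den S \<mm> I i +>\<^bsub>S\<^esub> x) (fiber_den S \<mm> I j +>\<^bsub>S\<^esub> y) =
         fiber_den S \<mm> I (i + j) +>\<^bsub>S\<^esub> (x \<otimes>\<^bsub>S\<^esub> y)"
proof -
  interpret cring S by fact
  let ?p = "ideal_pow S I" and ?d = "fiber_den S \<mm> I"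
  have idp: "ideal (?p n) S" for n using assms by (simp add: ideal_ideal_pow)
  have idd: "ideal (?d n) S" for n
    using assms idp by (simp add: fiber_den_def ideal_prod_is_ideal)
  have den_mult: "ideal_prod S (?d m) (?p n) = ?d (m + n)" for m n
    using assms idp by (simp add: fiber_den_def ideal_prod_assoc ideal_pow_mult)
  have den_sub: "?d n \<subseteq> ?p n" for n
    unfolding fiber_den_def using ideal_prod_inter[OF assms(2) idp] by blast
  have *: "u \<otimes>\<^bsub>S\<^esub> v \<in> ?d (m + n)" if "u \<in> ?d m" "v \<in> ?p n" for u v m n
    using ideal_prod.prod[OF that, of S] by (simp add: den_mult)
  interpret D: ideal "?d (i + j)" S by (rule idd)
  have xc: "x \<in> carrier S" and yc: "y \<in> carrier S"
    using x y idp ideal.Icarr by metis+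
  have rep: "?d (i + j) +>\<^bsub>S\<^esub> (u \<otimes>\<^bsub>S\<^esub> v) = ?d (i + j) +>\<^bsub>S\<^esub> (x \<otimes>\<^bsub>S\<^esub> y)"
    if u: "u \<in> ?d i +>\<^bsub>S\<^esub> x" and v: "v \<in> ?d j +>\<^bsub>S\<^esub> y" for u v
  proof -
    obtain p q where p: "p \<in> ?d i" "u = p \<oplus>\<^bsub>S\<^esub> x" and q: "q \<in> ?d j" "v = q \<oplus>\<^bsub>S\<^esub> y"
      using u v by (auto simp: a_r_coset_def')
    have pc: "p \<in> carrier S" and qc: "q \<in> carrier S"
      using p q idd ideal.Icarr by metis+
    have vp: "v \<in> ?p j"
      using q y den_sub additive_subgroup.a_closed[OF ideal.axioms(1)[OF idp]] by blast
    have vc: "v \<in> carrier S" using qc yc q by simp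
    have "p \<otimes>\<^bsub>S\<^esub> v \<in> ?d (i + j)" by (rule *[OF p(1) vp])
    moreover have "x \<otimes>\<^bsub>S\<^esub> q \<in> ?d (i + j)"
      using *[OF q(1) x] xc qc by (simp add: m_comm add.commute)
    ultimately have d: "p \<otimes>\<^bsub>S\<^esub> v \<oplus>\<^bsub>S\<^esub> x \<otimes>\<^bsub>S\<^esub> q \<in> ?d (i + j)" by simp
    have "u \<otimes>\<^bsub>S\<^esub> v = (p \<otimes>\<^bsub>S\<^esub> v \<oplus>\<^bsub>S\<^esub> x \<otimes>\<^bsub>S\<^esub> q) \<oplus>\<^bsub>S\<^esub> x \<otimes>\<^bsub>S\<^esub> y"
      using p q pc qc xc yc vc by (simp add: l_distr r_distr a_ac)
    then have "u \<otimes>\<^bsub>S\<^esub> v \<in> ?d (i + j) +>\<^bsub>S\<^esub> (x \<otimes>\<^bsub>S\<^esub> y)"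
      using d by (auto simp: a_r_coset_def')
    then show ?thesis
      using D.a_repr_independence'[of "u \<otimes>\<^bsub>S\<^esub> v" "x \<otimes>\<^bsub>S\<^esub> y"] xc yc by simp
  qed
  have "x \<in> ?d i +>\<^bsub>S\<^esub> x" "y \<in> ?d j +>\<^bsub>S\<^esub> y"
    using abelian_subgroup.a_rcos_self[OF abelian_subgroupI3[OF ideal.axioms(1)[OF idd] is_abelian_group]] xc yc
    by blast+
  moreover have "rcoset_mult S (?d (i + j)) (?d i +>\<^bsub>S\<^esub> x) (?d j +>\<^bsub>S\<^esub> y) =
      (\<Union>u \<in> ?d i +>\<^bsub>S\<^esub> x. \<Union>v \<in> ?d j +>\<^bsub>S\<^esub> y. ?d (i + j) +>\<^bsub>S\<^esub> (x \<otimes>\<^bsub>S\<^esub> y))"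
    unfolding rcoset_mult_def by (intro SUP_cong refl rep)
  ultimately show ?thesis by auto
qed

text \<open>\<open>\<Oplus>n. I\<^sup>n / \<mm> I\<^sup>n\<close>: an element is a finitely supported sequence \<open>f\<close> with \<open>f n\<close> a coset
  \<open>\<mm> I\<^sup>n + x\<close>, \<open>x \<in> I\<^sup>n\<close>.  The product of the classes of \<open>x \<in> I\<^sup>i\<close> and \<open>y \<in> I\<^sup>j\<close> is the class of
  \<open>x y\<close> in \<open>I\<^sup>i\<^sup>+\<^sup>j / \<mm> I\<^sup>i\<^sup>+\<^sup>j\<close>; since the two factors are cosets of different ideals, this uses
  \<^const>\<open>rcoset_mult\<close> rather than the multiplication of a single quotient ring.  The sum of the
  homogeneous contributions in degree \<open>n\<close> is formed in \<open>S / \<mm> I\<^sup>n\<close>, which contains \<open>I\<^sup>n / \<mm> I\<^sup>n\<close>.\<close>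

definition special_fiber_ring ::
    "('a, 'm) ring_scheme \<Rightarrow> 'a set \<Rightarrow> 'a set \<Rightarrow> (nat \<Rightarrow> 'a set) ring"
  where "special_fiber_ring S \<mm> I =
    \<lparr>carrier = {f. (\<forall>n. f n \<in> (\<lambda>x. fiber_den S \<mm> I n +>\<^bsub>S\<^esub> x) ` ideal_pow S I n) \<and>
                   finite {n. f n \<noteq> fiber_den S \<mm> I n}},
     monoid.mult = (\<lambda>f g n. finsum (S Quot fiber_den S \<mm> I n)
                       (\<lambda>i. rcoset_mult S (fiber_den S \<mm> I n) (f i) (g (n - i))) {..n}),
     one = (\<lambda>n. if n = 0 then fiber_den S \<mm> I 0 +>\<^bsub>S\<^esub> \<one>\<^bsub>S\<^esub> else fiber_den S \<mm> I n),
     ring.zero = fiber_den S \<mm> I,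
     add = (\<lambda>f g n. f n <+>\<^bsub>S\<^esub> g n)\<rparr>"

definition analytic_spread :: "'v set \<Rightarrow> ('v, 'k::field) mpolynomial set \<Rightarrow> enat"
  where "analytic_spread V I =
    krull_dim (special_fiber_ring (mpoly_ring V) (homogeneous_max_ideal V) I)"

end

theory Submission
  imports Defs "HOL-Library.Set_Algebras"
begin

text \<open>
  Since the generators of the edge ideal \<open>I\<close> all have degree two, the monomials of \<open>I\<^sup>n\<close> that survive in
  \<open>I\<^sup>n / \<mm> I\<^sup>n\<close> are exactly the products of \<open>n\<close> edge monomials, and the special fiber ring is isomorphic to the
  subalgebra of the polynomial ring generated by the edge monomials (\<open>fiber_class_iso\<close>).  It is the algebra of a monoid \<open>M\<close> of
  exponents, and its Krull dimension is bounded from both sides by elementary means.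

  Upper bound (\<open>krull_dim_monoid_algebra_le\<close>): choosing one element from each step of a chain of primes gives
  algebraically independent elements.  Their power products of bounded degree are linearly independent, so they cannot
  outnumber the monomials available.  If the exponents in \<open>M\<close> are determined by \<open>d\<close> of their coordinates, this
  forces the length of the chain to be at most \<open>d\<close>.

  Lower bound (\<open>krull_dim_monoid_algebra_ge\<close>): for a face \<open>F\<close> of \<open>M\<close>, the span of the monomials outside \<open>F\<close> is a
  prime ideal, so every chain of faces gives a chain of primes.

  The prime ideal graph is a complete split graph: \<open>P - {0}\<close> is a clique of size \<open>a\<close>, \<open>R - P\<close> is an independent set
  of size \<open>b\<close>, and all edges between them are present.  For \<open>a = 1\<close> it is a star, whose exponents are determined by
  the \<open>b\<close> leaves, and adding the leaves one by one gives \<open>b\<close> proper inclusions of faces (\<open>krull_dim_star\<close>).  For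
  \<open>a \<ge> 2\<close> there is an odd cycle, and a chain of faces of length \<open>a + b\<close>, the number of all variables, exists
  (\<open>krull_dim_complete_split\<close>).
\<close>

abbreviation keys :: "('t \<Rightarrow>\<^sub>0 'c::zero) \<Rightarrow> 't set"
  where "keys \<equiv> Poly_Mapping.keys"

abbreviation lookup :: "('t \<Rightarrow>\<^sub>0 'c::zero) \<Rightarrow> 't \<Rightarrow> 'c"
  where "lookup \<equiv> Poly_Mapping.lookup"

section \<open>Polynomials and their exponents\<close>

definition part :: "'t set \<Rightarrow> ('t \<Rightarrow>\<^sub>0 'k::zero) \<Rightarrow> ('t \<Rightarrow>\<^sub>0 'k)"
  where "part T = Poly_Mapping.mapp (\<lambda>t c. if t \<in> T then c else 0)"

lemma lookup_part: "lookup (part T p) t = (if t \<in> T then lookup p t else 0)"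
  by (auto simp: part_def lookup_mapp when_def in_keys_iff)

lemma keys_part: "keys (part T p) = keys p \<inter> T"
  by (auto simp: in_keys_iff lookup_part split: if_splits)

lemma part_add: "part T (p + q) = part T p + part T (q :: 't \<Rightarrow>\<^sub>0 'k::comm_monoid_add)"
  by (rule poly_mapping_eqI) (simp add: lookup_part lookup_add)

lemma part_sum: "part T (\<Sum>i\<in>A. f i) = (\<Sum>i\<in>A. part T (f i :: 't \<Rightarrow>\<^sub>0 'k::comm_monoid_add))"
  by (rule poly_mapping_eqI) (auto simp: lookup_part lookup_sum)

lemma part_eq_self: "keys p \<subseteq> T \<Longrightarrow> part T p = p"
  by (rule poly_mapping_eqI) (auto simp: lookup_part in_keys_iff)

lemma part_eq_0: "keys p \<inter> T = {} \<Longrightarrow> part T p = 0"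
  by (rule poly_mapping_eqI) (auto simp: lookup_part in_keys_iff)

lemma poly_mapping_sum_single:
  assumes "finite K" "keys p \<subseteq> K"
  shows "p = (\<Sum>t\<in>K. Poly_Mapping.single t (lookup p t :: 'k::comm_monoid_add))"
proof (rule poly_mapping_eqI)
  fix t
  have "(\<Sum>s\<in>K. lookup (Poly_Mapping.single s (lookup p s)) t) = (\<Sum>s\<in>K. if s = t then lookup p t else 0)"
    by (intro sum.cong) (auto simp: lookup_single)
  also have "\<dots> = lookup p t"
    using assms by (auto simp: in_keys_iff)
  finally show "lookup p t = lookup (\<Sum>t\<in>K. Poly_Mapping.single t (lookup p t)) t"
    by (simp add: lookup_sum)
qed

lemma lookup_mult_sum:
  fixes p q :: "'t::monoid_add \<Rightarrow>\<^sub>0 'k::semiring_0"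
  shows "lookup (p * q) t = (\<Sum>(r, s)\<in>keys p \<times> keys q.
           if r + s = t then lookup p r * lookup q s else 0)"
proof -
  let ?K = "keys p" and ?L = "keys q"
  have "p * q = (\<Sum>r\<in>?K. Poly_Mapping.single r (lookup p r)) * (\<Sum>s\<in>?L. Poly_Mapping.single s (lookup q s))"
    using poly_mapping_sum_single[of ?K p] poly_mapping_sum_single[of ?L q] by simp
  also have "\<dots> = (\<Sum>r\<in>?K. \<Sum>s\<in>?L. Poly_Mapping.single (r + s) (lookup p r * lookup q s))"
    by (simp add: sum_product mult_single)
  finally show ?thesis
    by (simp add: lookup_sum lookup_single when_def flip: sum.cartesian_product)
qed

lemma keys_uminus: "keys (- p) = keys (p :: 't \<Rightarrow>\<^sub>0 'k::ab_group_add)"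
  by (auto simp: in_keys_iff)

definition additive_submonoid :: "'t::monoid_add set \<Rightarrow> bool"
  where "additive_submonoid M \<longleftrightarrow> 0 \<in> M \<and> (\<forall>s\<in>M. \<forall>t\<in>M. s + t \<in> M)"

definition monoid_algebra :: "'t::comm_monoid_add set \<Rightarrow> ('t \<Rightarrow>\<^sub>0 'k::field) ring"
  where "monoid_algebra M =
    \<lparr>carrier = {p. keys p \<subseteq> M},
     monoid.mult = (*), one = 1, ring.zero = 0, add = (+)\<rparr>"

lemma monoid_algebra_simps [simp]:
  "p \<in> carrier (monoid_algebra M) \<longleftrightarrow> keys p \<subseteq> M"
  "p \<otimes>\<^bsub>monoid_algebra M\<^esub> q = p * q"
  "p \<oplus>\<^bsub>monoid_algebra M\<^esub> q = p + q"
  "\<one>\<^bsub>monoid_algebra M\<^esub> = 1"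
  "\<zero>\<^bsub>monoid_algebra M\<^esub> = 0"
  by (simp_all add: monoid_algebra_def)

lemma keys_mult_subset_submonoid:
  fixes p q :: "'t::monoid_add \<Rightarrow>\<^sub>0 'k::semiring_0"
  assumes "additive_submonoid M" "keys p \<subseteq> M" "keys q \<subseteq> M"
  shows "keys (p * q) \<subseteq> M"
proof -
  have "{r + s | r s. r \<in> keys p \<and> s \<in> keys q} \<subseteq> M"
    using assms by (auto simp: additive_submonoid_def)
  then show ?thesis using keys_mult[of p q] by blast
qed

lemma cring_monoid_algebra:
  assumes M: "additive_submonoid M"
  shows "cring (monoid_algebra M :: ('t::comm_monoid_add \<Rightarrow>\<^sub>0 'k::field) ring)"
proof (intro cringI abelian_groupI comm_monoidI)
  fix p :: "'t \<Rightarrow>\<^sub>0 'k"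
  assume "p \<in> carrier (monoid_algebra M)"
  then show "\<exists>q\<in>carrier (monoid_algebra M). q \<oplus>\<^bsub>monoid_algebra M\<^esub> p = \<zero>\<^bsub>monoid_algebra M\<^esub>"
    by (intro bexI[of _ "- p"]) (simp_all add: keys_uminus)
next
  fix p q :: "'t \<Rightarrow>\<^sub>0 'k"
  assume "p \<in> carrier (monoid_algebra M)" "q \<in> carrier (monoid_algebra M)"
  then show "p \<oplus>\<^bsub>monoid_algebra M\<^esub> q \<in> carrier (monoid_algebra M)"
    using Poly_Mapping.keys_add[of p q] by auto
qed (use M keys_mult_subset_submonoid[OF M] in
      \<open>simp_all add: algebra_simps additive_submonoid_def\<close>)

section \<open>Faces of exponent monoids and monomial primes\<close>

text \<open>The two exponents play the role of leading exponents under a monomial order.  As long as some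
  variable distinguishes two elements of \<open>K\<close> or of \<open>L\<close>, both sets are cut down to the exponents
  that are maximal in that variable: a sum of two such exponents can only be reached by two such
  exponents.\<close>

lemma unique_sum:
  fixes K L :: "('v \<Rightarrow>\<^sub>0 nat) set"
  assumes "finite K" "finite L" "K \<noteq> {}" "L \<noteq> {}"
  shows "\<exists>s\<in>K. \<exists>t\<in>L. \<forall>s'\<in>K. \<forall>t'\<in>L. s' + t' = s + t \<longrightarrow> s' = s \<and> t' = t"
  using assms
proof (induction "card K + card L" arbitrary: K L rule: less_induct)
  case less
  show ?case
  proof (cases "\<exists>v. \<exists>s\<in>K. \<exists>s'\<in>K. \<exists>t\<in>L. \<exists>t'\<in>L. lookup s v \<noteq> lookup s' v \<or> lookup t v \<noteq> lookup t' v")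
    case False
    then have "\<forall>s\<in>K. \<forall>s'\<in>K. s = s'" "\<forall>t\<in>L. \<forall>t'\<in>L. t = t'"
      using less.prems by (blast intro: poly_mapping_eqI)+
    then show ?thesis using less.prems by blast
  next
    case True
    then obtain v where v: "\<exists>s\<in>K. \<exists>s'\<in>K. \<exists>t\<in>L. \<exists>t'\<in>L. lookup s v \<noteq> lookup s' v \<or> lookup t v \<noteq> lookup t' v"
      by blast
    define top where "top A = {s\<in>A. \<forall>s'\<in>A. lookup s' v \<le> lookup s v}" for A :: "('v \<Rightarrow>\<^sub>0 nat) set"
    have top_ne: "top A \<noteq> {}" if A: "finite A" "A \<noteq> {}" for A
    proof -
      have "Max ((\<lambda>s. lookup s v) ` A) \<in> (\<lambda>s. lookup s v) ` A"
        using A by (intro Max_in) auto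
      then obtain s where "s \<in> A" "lookup s v = Max ((\<lambda>s. lookup s v) ` A)" by force
      then have "s \<in> top A" using A by (auto simp: top_def)
      then show ?thesis by blast
    qed
    have sub: "top K \<subseteq> K" "top L \<subseteq> L" by (auto simp: top_def)
    have const: "lookup s v = lookup s' v" if "top A = A" "s \<in> A" "s' \<in> A" for A s s'
      using that unfolding top_def by (simp add: set_eq_iff) (metis order_antisym)
    have "top K \<noteq> K \<or> top L \<noteq> L"
      using v const[of K] const[of L] by blast
    then have "card (top K) + card (top L) < card K + card L"
    proof
      assume "top K \<noteq> K"
      then have "card (top K) < card K" using sub less.prems by (intro psubset_card_mono) auto
      moreover have "card (top L) \<le> card L" using sub less.prems by (intro card_mono)
      ultimately show ?thesis by linarith
    next
      assume "top L \<noteq> L"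
      then have "card (top L) < card L" using sub less.prems by (intro psubset_card_mono) auto
      moreover have "card (top K) \<le> card K" using sub less.prems by (intro card_mono)
      ultimately show ?thesis by linarith
    qed
    then obtain s t where st: "s \<in> top K" "t \<in> top L"
      and uniq: "\<And>s' t'. s' \<in> top K \<Longrightarrow> t' \<in> top L \<Longrightarrow> s' + t' = s + t \<Longrightarrow> s' = s \<and> t' = t"
      using less.hyps[of "top K" "top L"] top_ne[of K] top_ne[of L] less.prems
        finite_subset[OF sub(1)] finite_subset[OF sub(2)] by auto
    have "s' = s \<and> t' = t" if s't': "s' \<in> K" "t' \<in> L" "s' + t' = s + t" for s' t'
    proof -
      have "lookup s' v + lookup t' v = lookup s v + lookup t v"
        using s't'(3) by (metis lookup_add)
      moreover have "lookup s' v \<le> lookup s v" "lookup t' v \<le> lookup t v"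
        using st s't' by (auto simp: top_def)
      ultimately have "lookup s' v = lookup s v" "lookup t' v = lookup t v" by simp_all
      then have "s' \<in> top K" "t' \<in> top L" using st s't' by (auto simp: top_def)
      then show ?thesis using uniq s't'(3) by blast
    qed
    then show ?thesis using st sub by blast
  qed
qed

text \<open>The faces are the submonoids whose complement is a prime ideal of the monoid.\<close>

definition face :: "'t::monoid_add set \<Rightarrow> 't set \<Rightarrow> bool"
  where "face M F \<longleftrightarrow> 0 \<in> F \<and> F \<subseteq> M \<and> (\<forall>s\<in>M. \<forall>t\<in>M. s + t \<in> F \<longleftrightarrow> s \<in> F \<and> t \<in> F)"

lemma faceI:
  assumes "0 \<in> F" "F \<subseteq> M" "\<And>s t. s \<in> M \<Longrightarrow> t \<in> M \<Longrightarrow> s + t \<in> F \<longleftrightarrow> s \<in> F \<and> t \<in> F"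
  shows "face M F"
  using assms by (simp add: face_def)

lemma keys_add_nat: "keys (s + t :: 'v \<Rightarrow>\<^sub>0 nat) = keys s \<union> keys t"
  by (auto simp: in_keys_iff lookup_add)

lemma face_support:
  fixes M :: "('v \<Rightarrow>\<^sub>0 nat) set"
  assumes "additive_submonoid M"
  shows "face M {t \<in> M. keys t \<subseteq> W}"
  using assms by (intro faceI) (auto simp: additive_submonoid_def keys_add_nat)

text \<open>A face in the sense of convex geometry: the exponents where a linear inequality valid on the monoid
  becomes an equality.\<close>

lemma face_tight:
  fixes f g :: "'t::monoid_add \<Rightarrow> nat"
  assumes M: "additive_submonoid M"
    and add: "\<And>s t. f (s + t) = f s + f t" "\<And>s t. g (s + t) = g s + g t"
    and le: "\<And>t. t \<in> M \<Longrightarrow> g t \<le> f t"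
  shows "face M {t \<in> M. g t = f t}"
proof (rule faceI)
  have "f 0 = 0" "g 0 = 0" using add(1)[of 0 0] add(2)[of 0 0] by simp_all
  then show "0 \<in> {t \<in> M. g t = f t}" using M by (simp add: additive_submonoid_def)
  show "s + t \<in> {t \<in> M. g t = f t} \<longleftrightarrow> s \<in> {t \<in> M. g t = f t} \<and> t \<in> {t \<in> M. g t = f t}"
    if "s \<in> M" "t \<in> M" for s t
    using that M le[of s] le[of t] by (auto simp: additive_submonoid_def add)
qed auto

lemma face_Int: "face M F \<Longrightarrow> face M F' \<Longrightarrow> face M (F \<inter> F')"
  by (auto simp: face_def)

definition monomial_span :: "'t set \<Rightarrow> ('t \<Rightarrow>\<^sub>0 'k::zero) set"
  where "monomial_span D = {p. keys p \<subseteq> D}"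

lemma monomial_span_add: "p \<in> monomial_span D \<Longrightarrow> q \<in> monomial_span D \<Longrightarrow> p + q \<in> monomial_span D"
  using Poly_Mapping.keys_add[of p q] by (auto simp: monomial_span_def)

lemma monomial_span_uminus:
  "p \<in> monomial_span D \<Longrightarrow> - (p :: 't \<Rightarrow>\<^sub>0 'k::ab_group_add) \<in> monomial_span D"
  by (simp add: monomial_span_def keys_uminus)

lemma monomial_span_mult:
  fixes p q :: "'t::monoid_add \<Rightarrow>\<^sub>0 'k::semiring_0"
  assumes "p \<in> monomial_span D" "q \<in> monomial_span D'"
  shows "p * q \<in> monomial_span (D + D')"
proof -
  have "{r + s | r s. r \<in> keys p \<and> s \<in> keys q} \<subseteq> D + D'"
    using assms by (auto simp: monomial_span_def)
  then show ?thesis using keys_mult[of p q] by (auto simp: monomial_span_def)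
qed

lemma ideal_monomial_span:
  assumes M: "additive_submonoid M" and D: "D \<subseteq> M" "D + M \<subseteq> D"
  shows "ideal (monomial_span D) (monoid_algebra M :: ('t::comm_monoid_add \<Rightarrow>\<^sub>0 'k::field) ring)"
proof -
  let ?A = "monoid_algebra M :: ('t \<Rightarrow>\<^sub>0 'k) ring"
  let ?P = "monomial_span D :: ('t \<Rightarrow>\<^sub>0 'k) set"
  interpret cring ?A by (rule cring_monoid_algebra[OF M])
  have sub: "?P \<subseteq> carrier ?A" using D by (auto simp: monomial_span_def)
  have neg: "\<ominus>\<^bsub>?A\<^esub> p = - p" if "p \<in> ?P" for p
  proof (rule minus_equality)
    have "p \<in> carrier ?A" using sub that by blast
    then show "p \<in> carrier ?A" "- p \<in> carrier ?A" by (simp_all add: keys_uminus)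
  qed simp
  show ?thesis
  proof (rule idealI[OF ring_axioms])
    show "subgroup ?P (add_monoid ?A)"
    proof (rule add.subgroupI)
      have "0 \<in> ?P" by (simp add: monomial_span_def)
      then show "?P \<noteq> {}" by blast
    qed (use sub neg monomial_span_uminus monomial_span_add in \<open>simp_all\<close>)
    have *: "p * q \<in> ?P" if "p \<in> ?P" "q \<in> carrier ?A" for p q
      using monomial_span_mult[OF that(1), of q M] that(2) D(2) by (auto simp: monomial_span_def)
    show "q \<otimes>\<^bsub>?A\<^esub> p \<in> ?P" "p \<otimes>\<^bsub>?A\<^esub> q \<in> ?P" if "p \<in> ?P" "q \<in> carrier ?A" for p q
      using *[OF that] by (simp_all add: mult.commute)
  qed
qed

text \<open>If neither factor lies in the span of \<open>M - F\<close>, a unique sum of exponents from the parts of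
  the two factors on \<open>F\<close> is a face exponent; as sums in \<open>F\<close> come only from summands in \<open>F\<close>, its coefficient in
  the product is a product of two nonzero coefficients.\<close>

lemma primeideal_off_face:
  fixes M :: "('v \<Rightarrow>\<^sub>0 nat) set"
  assumes M: "additive_submonoid M" and F: "face M F"
  shows "primeideal (monomial_span (M - F)) (monoid_algebra M :: ('v, 'k::field) mpolynomial ring)"
proof -
  let ?A = "monoid_algebra M :: ('v, 'k) mpolynomial ring"
  let ?P = "monomial_span (M - F) :: ('v, 'k) mpolynomial set"
  interpret cring ?A by (rule cring_monoid_algebra[OF M])
  have "M - F + M \<subseteq> M - F"
    using M F by (auto simp: face_def additive_submonoid_def elim!: set_plus_elim)
  then have ideal: "ideal ?P ?A" by (intro ideal_monomial_span[OF M]) auto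
  show ?thesis
  proof (rule primeidealI[OF ideal cring_axioms])
    have "(1 :: ('v, 'k) mpolynomial) \<in> carrier ?A" "(1 :: ('v, 'k) mpolynomial) \<notin> ?P"
      using M F by (auto simp: monomial_span_def face_def additive_submonoid_def)
    then show "carrier ?A \<noteq> ?P" by blast
  next
    fix p q :: "('v, 'k) mpolynomial"
    assume "p \<in> carrier ?A" "q \<in> carrier ?A" and pq: "p \<otimes>\<^bsub>?A\<^esub> q \<in> ?P"
    then have pqM: "keys p \<subseteq> M" "keys q \<subseteq> M" by auto
    show "p \<in> ?P \<or> q \<in> ?P"
    proof (rule ccontr)
      assume "\<not> ?thesis"
      then have "keys p \<inter> F \<noteq> {}" "keys q \<inter> F \<noteq> {}"
        using pqM by (auto simp: monomial_span_def)
      then obtain r s where r: "r \<in> keys p" "r \<in> F" and s: "s \<in> keys q" "s \<in> F"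
        and uniq: "\<And>r' s'. r' \<in> keys p \<inter> F \<Longrightarrow> s' \<in> keys q \<inter> F \<Longrightarrow>
                     r' + s' = r + s \<Longrightarrow> r' = r \<and> s' = s"
        using unique_sum[of "keys p \<inter> F" "keys q \<inter> F"] by auto
      have rs: "r + s \<in> F" using r s F unfolding face_def by blast
      have "r' = r \<and> s' = s" if "r' \<in> keys p" "s' \<in> keys q" "r' + s' = r + s" for r' s'
      proof -
        have "r' \<in> F" "s' \<in> F"
          using that rs F pqM unfolding face_def by (metis subsetD)+
        then show ?thesis using uniq that by blast
      qed
      then have "(case z of (r', s') \<Rightarrow> if r' + s' = r + s then lookup p r' * lookup q s' else 0) =
          (if z = (r, s) then lookup p r * lookup q s else 0)" if "z \<in> keys p \<times> keys q" for z
        using that by (cases z) auto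
      then have "lookup (p * q) (r + s) =
          (\<Sum>z\<in>keys p \<times> keys q. if z = (r, s) then lookup p r * lookup q s else 0)"
        unfolding lookup_mult_sum by (intro sum.cong refl)
      also have "\<dots> = lookup p r * lookup q s"
        using r s by simp
      finally have "r + s \<in> keys (p * q)"
        using r s by (simp add: in_keys_iff)
      then show False using pq rs by (auto simp: monomial_span_def)
    qed
  qed
qed

text \<open>Larger faces give smaller primes, so the chain of faces is traversed downwards.\<close>

lemma krull_dim_monoid_algebra_ge:
  fixes F :: "nat \<Rightarrow> ('v \<Rightarrow>\<^sub>0 nat) set"
  assumes M: "additive_submonoid M"
    and F: "\<And>j. j \<le> n \<Longrightarrow> face M (F j)"
    and strict: "\<And>j. j < n \<Longrightarrow> F j \<subset> F (Suc j)"
  shows "enat n \<le> krull_dim (monoid_algebra M :: ('v, 'k::field) mpolynomial ring)"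
proof -
  let ?C = "\<lambda>i. monomial_span (M - F (n - i)) :: ('v, 'k) mpolynomial set"
  have "\<forall>i\<le>n. primeideal (?C i) (monoid_algebra M)"
    by (intro allI impI primeideal_off_face[OF M F]) simp
  moreover have "?C i \<subset> ?C (Suc i)" if i: "i < n" for i
  proof -
    have *: "F (n - Suc i) \<subset> F (n - i)"
      using strict[of "n - Suc i"] i by (simp add: Suc_diff_Suc)
    then obtain t where t: "t \<in> F (n - i)" "t \<notin> F (n - Suc i)" by blast
    have "t \<in> M" using F[of "n - i"] t by (auto simp: face_def)
    then have "Poly_Mapping.single t 1 \<in> ?C (Suc i)" "Poly_Mapping.single t 1 \<notin> ?C i"
      using t by (auto simp: monomial_span_def)
    moreover have "?C i \<subseteq> ?C (Suc i)" using * by (auto simp: monomial_span_def)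
    ultimately show ?thesis by blast
  qed
  ultimately have "\<exists>C. (\<forall>i\<le>n. primeideal (C i) (monoid_algebra M :: ('v, 'k) mpolynomial ring)) \<and>
      (\<forall>i<n. C i \<subset> C (Suc i))"
    by (intro exI[of _ ?C]) simp
  then show ?thesis
    unfolding krull_dim_def by (intro Sup_upper CollectI exI[of _ n]) simp
qed

section \<open>Upper bound for the dimension of a monoid algebra\<close>

text \<open>Gaussian elimination: a homogeneous linear system with fewer equations than unknowns has a
  nonzero solution.\<close>

lemma nontrivial_relation:
  fixes v :: "'j \<Rightarrow> 't \<Rightarrow> 'k::field"
  assumes "finite B" "finite J" "card B < card J"
  shows "\<exists>c. (\<exists>j\<in>J. c j \<noteq> 0) \<and> (\<forall>t\<in>B. (\<Sum>j\<in>J. c j * v j t) = 0)"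
  using assms
proof (induction B arbitrary: J v rule: finite_induct)
  case empty
  then have "J \<noteq> {}" by auto
  then show ?case by (intro exI[of _ "\<lambda>_. 1"]) auto
next
  case (insert b B)
  show ?case
  proof (cases "\<forall>j\<in>J. v j b = 0")
    case True
    obtain c where "\<exists>j\<in>J. c j \<noteq> 0" "\<forall>t\<in>B. (\<Sum>j\<in>J. c j * v j t) = 0"
      using insert.IH[of J v] insert.prems insert.hyps by auto
    with True show ?thesis by (intro exI[of _ c]) simp
  next
    case False
    then obtain i where i: "i \<in> J" "v i b \<noteq> 0" by blast
    define w where "w = (\<lambda>j t. v j t - v j b / v i b * v i t)"
    have "card B < card (J - {i})"
      using insert.prems insert.hyps i by simp
    then obtain c where c: "\<exists>j\<in>J - {i}. c j \<noteq> 0" "\<forall>t\<in>B. (\<Sum>j\<in>J - {i}. c j * w j t) = 0"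
      using insert.IH[of "J - {i}" w] insert.prems by auto
    define c' where "c' = c(i := - (\<Sum>j\<in>J - {i}. c j * v j b / v i b))"
    have eq: "(\<Sum>j\<in>J. c' j * v j t) = (\<Sum>j\<in>J - {i}. c j * w j t)" for t
    proof -
      have "(\<Sum>j\<in>J. c' j * v j t) = c' i * v i t + (\<Sum>j\<in>J - {i}. c' j * v j t)"
        using insert.prems i by (simp add: sum.remove)
      also have "(\<Sum>j\<in>J - {i}. c' j * v j t) = (\<Sum>j\<in>J - {i}. c j * v j t)"
        by (intro sum.cong) (auto simp: c'_def)
      also have "c' i * v i t = (\<Sum>j\<in>J - {i}. - (c j * v j b / v i b * v i t))"
        by (simp add: c'_def sum_distrib_right sum_negf)
      finally show ?thesis
        by (simp add: w_def algebra_simps flip: sum.distrib)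
    qed
    have "w j b = 0" for j using i by (simp add: w_def)
    then have "\<forall>t\<in>insert b B. (\<Sum>j\<in>J. c' j * v j t) = 0"
      using c(2) by (simp add: eq)
    moreover have "\<exists>j\<in>J. c' j \<noteq> 0" using c(1) by (auto simp: c'_def)
    ultimately show ?thesis by blast
  qed
qed

lemma keys_sum_subset:
  assumes "\<And>i. i \<in> A \<Longrightarrow> keys (f i :: 't \<Rightarrow>\<^sub>0 'k::comm_monoid_add) \<subseteq> M"
  shows "keys (\<Sum>i\<in>A. f i) \<subseteq> M"
  using assms
proof (induction A rule: infinite_finite_induct)
  case (insert a A)
  then show ?case using Poly_Mapping.keys_add[of "f a" "sum f A"] by auto
qed auto

lemma keys_power_subset:
  fixes p :: "'t::comm_monoid_add \<Rightarrow>\<^sub>0 'k::comm_semiring_1"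
  assumes "additive_submonoid M" "keys p \<subseteq> M"
  shows "keys (p ^ e) \<subseteq> M"
  by (induction e)
     (use assms keys_mult_subset_submonoid[OF assms(1)] in \<open>simp_all add: additive_submonoid_def\<close>)

lemma keys_prod_subset:
  fixes f :: "'i \<Rightarrow> 't::comm_monoid_add \<Rightarrow>\<^sub>0 'k::comm_semiring_1"
  assumes "additive_submonoid M" "\<And>i. i \<in> A \<Longrightarrow> keys (f i) \<subseteq> M"
  shows "keys (\<Prod>i\<in>A. f i) \<subseteq> M"
  using assms(2)
proof (induction A rule: infinite_finite_induct)
  case (insert a A)
  then show ?case by (simp add: keys_mult_subset_submonoid[OF assms(1)])
qed (use assms(1) in \<open>simp_all add: additive_submonoid_def\<close>)

lemma primeideal_monoid_algebraD:
  fixes Q :: "('t::comm_monoid_add \<Rightarrow>\<^sub>0 'k::field) set"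
  assumes Q: "primeideal Q (monoid_algebra M)" and M: "additive_submonoid M"
  shows "p \<in> Q \<Longrightarrow> keys p \<subseteq> M"
    and "p \<in> Q \<Longrightarrow> q \<in> Q \<Longrightarrow> p - q \<in> Q"
    and "p \<in> Q \<Longrightarrow> keys q \<subseteq> M \<Longrightarrow> q * p \<in> Q"
    and "keys p \<subseteq> M \<Longrightarrow> keys q \<subseteq> M \<Longrightarrow> p * q \<in> Q \<Longrightarrow> p \<in> Q \<or> q \<in> Q"
    and "1 \<notin> Q"
proof -
  let ?A = "monoid_algebra M :: ('t \<Rightarrow>\<^sub>0 'k) ring"
  interpret primeideal Q ?A by (rule Q)
  show keysD: "keys p \<subseteq> M" if "p \<in> Q" for p using Icarr[OF that] by simp
  show mult: "q * p \<in> Q" if "p \<in> Q" "keys q \<subseteq> M" for p q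
    using I_l_closed[OF that(1), of q] that by simp
  show "p * q \<in> Q \<Longrightarrow> p \<in> Q \<or> q \<in> Q" if "keys p \<subseteq> M" "keys q \<subseteq> M"
    using I_prime[of p q] that by simp
  show "p - q \<in> Q" if "p \<in> Q" "q \<in> Q"
    using additive_subgroup.a_closed[OF additive_subgroup_axioms that(1) mult[OF that(2), of "- 1"]] M
    by (simp add: keys_uminus additive_submonoid_def)
  show "1 \<notin> Q"
  proof
    assume "1 \<in> Q"
    then have "carrier ?A \<subseteq> Q" using mult[of 1] by auto
    then show False using I_notcarr a_subset by blast
  qed
qed

text \<open>Elements \<open>x i\<close> that enter a chain of primes one at a time are algebraically independent over
  the field.  In a relation among their power products, the least power of \<open>x k\<close> can be cancelled modulo the
  prime \<open>C k\<close>, which does not contain \<open>x k\<close>.  The terms that still contain \<open>x k\<close> lie in \<open>C (Suc k)\<close>, so the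
  remaining ones form a relation among the later elements modulo \<open>C (Suc k)\<close>.  At the end of the chain a single
  coefficient is left, and a proper ideal contains no nonzero constant.\<close>

lemma power_products_independent:
  fixes C :: "nat \<Rightarrow> ('t::comm_monoid_add \<Rightarrow>\<^sub>0 'k::field) set"
  assumes M: "additive_submonoid M"
    and prime: "\<And>i. i \<le> n \<Longrightarrow> primeideal (C i) (monoid_algebra M)"
    and mono: "\<And>i. i < n \<Longrightarrow> C i \<subseteq> C (Suc i)"
    and x: "\<And>i. i < n \<Longrightarrow> x i \<in> C (Suc i) - C i"
    and "k \<le> n" "finite J"
    and "\<And>m m'. m \<in> J \<Longrightarrow> m' \<in> J \<Longrightarrow> (\<And>i. k \<le> i \<Longrightarrow> i < n \<Longrightarrow> m i = m' i) \<Longrightarrow> m = m'"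
    and "(\<Sum>m\<in>J. Poly_Mapping.single 0 (c m) * (\<Prod>i\<in>{k..<n}. x i ^ m i)) \<in> C k"
    and "m \<in> J"
  shows "c m = 0"
  using assms(5-)
proof (induction k arbitrary: J m rule: inc_induct)
  case base
  note D = primeideal_monoid_algebraD[OF prime[OF order_refl] M]
  have "m' = m" if "m' \<in> J" for m'
    by (rule base.prems(2)[OF that base.prems(4)]) simp
  then have "J = {m}" using base.prems(4) by blast
  then have *: "Poly_Mapping.single 0 (c m) \<in> C n" using base.prems(3) by simp
  show "c m = 0"
  proof (rule ccontr)
    assume "c m \<noteq> 0"
    moreover have "Poly_Mapping.single 0 (inverse (c m)) * Poly_Mapping.single 0 (c m) \<in> C n"
      using D(3)[OF *] M by (simp add: additive_submonoid_def)
    ultimately show False using D(5) by (simp add: mult_single)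
  qed
next
  case (step k)
  note D = primeideal_monoid_algebraD[OF prime M]
  define R where "R = (\<lambda>m. Poly_Mapping.single 0 (c m) * (\<Prod>i\<in>{Suc k..<n}. x i ^ m i))"
  have kn: "k < n" using step.hyps by simp
  have xM: "keys (x i) \<subseteq> M" if "i < n" for i
    using x[OF that] D(1)[of "Suc i" "x i"] that by auto
  have RM: "keys (R m) \<subseteq> M" for m
    unfolding R_def using M
    by (intro keys_mult_subset_submonoid keys_prod_subset keys_power_subset xM)
       (auto simp: additive_submonoid_def)
  show "c m = 0"
  proof (rule ccontr)
    assume "c m \<noteq> 0"
    define J' where "J' = {m\<in>J. c m \<noteq> 0}"
    have J': "finite J'" "m \<in> J'" using step.prems \<open>c m \<noteq> 0\<close> by (auto simp: J'_def)
    define e where "e = Min ((\<lambda>m. m k) ` J')"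
    have "e \<in> (\<lambda>m. m k) ` J'" unfolding e_def using J' by (intro Min_in) auto
    then obtain m0 where m0: "m0 \<in> J'" "m0 k = e" by auto
    have e_le: "e \<le> m k" if "m \<in> J'" for m
      unfolding e_def using J' that by (intro Min_le) auto
    \<comment> \<open>The relation becomes \<open>x k ^ e * (S + x k * T)\<close>, where \<open>S\<close> collects the terms with the least
      power of \<open>x k\<close>.\<close>
    define S where "S = (\<Sum>m\<in>{m\<in>J'. m k = e}. R m)"
    define T where "T = (\<Sum>m\<in>{m\<in>J'. m k \<noteq> e}. x k ^ (m k - Suc e) * R m)"
    have "(\<Sum>m\<in>J. Poly_Mapping.single 0 (c m) * (\<Prod>i\<in>{k..<n}. x i ^ m i)) = (\<Sum>m\<in>J. x k ^ m k * R m)"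
      using kn by (intro sum.cong) (simp_all add: R_def prod.atLeast_Suc_lessThan mult.left_commute)
    also have "\<dots> = (\<Sum>m\<in>J'. x k ^ m k * R m)"
      using step.prems(1) by (intro sum.mono_neutral_right) (auto simp: J'_def R_def)
    also have "\<dots> = (\<Sum>m\<in>{m\<in>J'. m k = e} \<union> {m\<in>J'. m k \<noteq> e}. x k ^ m k * R m)"
      by (intro sum.cong) auto
    also have "\<dots> = (\<Sum>m\<in>{m\<in>J'. m k = e}. x k ^ m k * R m) + (\<Sum>m\<in>{m\<in>J'. m k \<noteq> e}. x k ^ m k * R m)"
      using J' by (intro sum.union_disjoint) auto
    also have "(\<Sum>m\<in>{m\<in>J'. m k = e}. x k ^ m k * R m) = x k ^ e * S"
      unfolding S_def sum_distrib_left by (intro sum.cong) auto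
    also have "(\<Sum>m\<in>{m\<in>J'. m k \<noteq> e}. x k ^ m k * R m) = x k ^ e * (x k * T)"
    proof -
      have "x k ^ m k = x k ^ e * (x k * x k ^ (m k - Suc e))" if "m \<in> J'" "m k \<noteq> e" for m
      proof -
        have "m k = e + Suc (m k - Suc e)" using e_le[OF that(1)] that(2) by simp
        then have "x k ^ m k = x k ^ (e + Suc (m k - Suc e))" by simp
        then show ?thesis by (simp add: power_add)
      qed
      then show ?thesis
        unfolding T_def sum_distrib_left by (intro sum.cong) (auto simp: mult.assoc)
    qed
    finally have sum_in: "x k ^ e * (S + x k * T) \<in> C k"
      using step.prems(3) by (simp add: algebra_simps)
    have SM: "keys S \<subseteq> M" unfolding S_def by (intro keys_sum_subset RM)
    have TM: "keys T \<subseteq> M" unfolding T_def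
      by (intro keys_sum_subset keys_mult_subset_submonoid[OF M] keys_power_subset[OF M] RM xM kn)
    have STM: "keys (S + x k * T) \<subseteq> M"
      using Poly_Mapping.keys_add[of S "x k * T"] SM keys_mult_subset_submonoid[OF M xM[OF kn] TM]
      by blast
    have pow: "x k ^ e * p \<in> C k \<Longrightarrow> p \<in> C k" if "keys p \<subseteq> M" for e p
    proof (induction e)
      case (Suc e)
      have "keys (x k ^ e * p) \<subseteq> M"
        by (intro keys_mult_subset_submonoid[OF M] keys_power_subset[OF M] that xM kn)
      then have "x k ^ e * p \<in> C k"
        using Suc.prems D(4)[of k "x k" "x k ^ e * p"] x[OF kn] xM[OF kn] kn by (auto simp: mult.assoc)
      then show ?case by (rule Suc.IH)
    qed simp
    have "S + x k * T \<in> C (Suc k)" using pow[OF STM sum_in] mono[OF kn] by blast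
    moreover have "x k * T \<in> C (Suc k)"
      using D(3)[of "Suc k" "x k" T] x[OF kn] kn TM by (auto simp: mult.commute)
    ultimately have "S \<in> C (Suc k)"
      using D(2)[of "Suc k" "S + x k * T" "x k * T"] kn by simp
    then have "c m0 = 0"
    proof (intro step.IH[of "{m\<in>J'. m k = e}" m0])
      show "finite {m \<in> J'. m k = e}" using J' by simp
      show "m = m'" if "m \<in> {m \<in> J'. m k = e}" "m' \<in> {m \<in> J'. m k = e}"
        "\<And>i. Suc k \<le> i \<Longrightarrow> i < n \<Longrightarrow> m i = m' i" for m m'
      proof (rule step.prems(2))
        show "m \<in> J" "m' \<in> J" using that by (auto simp: J'_def)
        show "m i = m' i" if "k \<le> i" "i < n" for i
          using that \<open>m \<in> {m \<in> J'. m k = e}\<close> \<open>m' \<in> {m \<in> J'. m k = e}\<close>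
            \<open>\<And>i. Suc k \<le> i \<Longrightarrow> i < n \<Longrightarrow> m i = m' i\<close>[of i] by (cases "i = k") auto
      qed
    qed (use m0 in \<open>simp_all add: S_def R_def\<close>)
    then show False using m0 by (simp add: J'_def)
  qed
qed

text \<open>If the exponents in \<open>M\<close> are determined by their values on \<open>W\<close>, the monomials with values at most
  \<open>K\<close> on \<open>W\<close> number at most \<open>(K + 1)\<close> to the power \<open>card W\<close>.  A chain of \<open>n > card W\<close> steps would give \<open>n\<close>
  algebraically independent elements, hence \<open>N ^ n\<close> linearly independent power products with exponents below
  \<open>N\<close>.  These have \<open>K\<close> linear in \<open>N\<close>, and for large \<open>N\<close> there are not enough monomials for them.\<close>

lemma krull_dim_monoid_algebra_le:
  fixes M :: "('v \<Rightarrow>\<^sub>0 nat) set"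
  assumes M: "additive_submonoid M" and W: "finite W"
    and inj: "\<And>s t. s \<in> M \<Longrightarrow> t \<in> M \<Longrightarrow> (\<And>v. v \<in> W \<Longrightarrow> lookup s v = lookup t v) \<Longrightarrow> s = t"
  shows "krull_dim (monoid_algebra M :: ('v, 'k::field) mpolynomial ring) \<le> enat (card W)"
proof -
  let ?A = "monoid_algebra M :: ('v, 'k) mpolynomial ring"
  have "n \<le> card W"
    if prime: "\<And>i. i \<le> n \<Longrightarrow> primeideal (C i) ?A" and strict: "\<And>i. i < n \<Longrightarrow> C i \<subset> C (Suc i)"
    for n and C
  proof (rule ccontr)
    assume "\<not> ?thesis"
    then have n: "card W < n" by simp
    have "\<forall>i. \<exists>y. i < n \<longrightarrow> y \<in> C (Suc i) - C i" using strict by blast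
    then obtain x where x: "\<And>i. i < n \<Longrightarrow> x i \<in> C (Suc i) - C i" by metis
    have xM: "keys (x i) \<subseteq> M" if "i < n" for i
      using x[OF that] primeideal_monoid_algebraD(1)[OF prime M, of "Suc i" "x i"] that by auto
    have "finite (\<Union>i<n. \<Union>t\<in>keys (x i). lookup t ` W)" using W by auto
    then obtain D where "\<forall>d\<in>(\<Union>i<n. \<Union>t\<in>keys (x i). lookup t ` W). d \<le> D"
      unfolding finite_nat_set_iff_bounded_le by blast
    then have D: "lookup t v \<le> D" if "i < n" "t \<in> keys (x i)" "v \<in> W" for i t v
      using that by auto
    define B where "B K = {t\<in>M. \<forall>v\<in>W. lookup t v \<le> K}" for K
    \<comment> \<open>On \<open>W\<close> the monomials of a power product have values at most \<open>n * (N * D)\<close>, which leaves at most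
      \<open>c0 * N\<close> possibilities for each variable; \<open>N\<close> is chosen larger than \<open>c0 ^ card W\<close>, so that
      \<open>(c0 * N) ^ card W\<close> stays below \<open>N ^ Suc (card W)\<close>.\<close>
    define c0 where "c0 = Suc (n * D)"
    define N where "N = Suc (c0 ^ card W)"
    define J where "J = ({..<n} \<rightarrow>\<^sub>E {..<N})"
    define y where "y m = (\<Prod>i<n. x i ^ m i)" for m :: "nat \<Rightarrow> nat"

    have B_inj: "inj_on (\<lambda>t. restrict (lookup t) W) (B K)" for K
    proof (rule inj_onI)
      fix s t assume st: "s \<in> B K" "t \<in> B K" and eq: "restrict (lookup s) W = restrict (lookup t) W"
      have "lookup s v = lookup t v" if "v \<in> W" for v
        using fun_cong[OF eq, of v] that by simp
      then show "s = t" using inj st by (auto simp: B_def)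
    qed
    have B_img: "(\<lambda>t. restrict (lookup t) W) ` B K \<subseteq> W \<rightarrow>\<^sub>E {..K}" for K
      by (auto simp: B_def)
    have fin_PiE: "finite (W \<rightarrow>\<^sub>E {..K})" for K :: nat using W by (intro finite_PiE) auto
    have finB: "finite (B K)" for K
      using B_inj B_img fin_PiE by (rule inj_on_finite)
    have "card (B K) \<le> card (W \<rightarrow>\<^sub>E {..K})" for K
      using B_inj B_img fin_PiE by (rule card_inj_on_le)
    then have cardB: "card (B K) \<le> Suc K ^ card W" for K
      using W by (simp add: card_PiE)

    have B_mult: "keys (p * q) \<subseteq> B (a + b)" if "keys p \<subseteq> B a" "keys q \<subseteq> B b"
      for p q :: "('v, 'k) mpolynomial" and a b
    proof -
      have "r + s \<in> B (a + b)" if "r \<in> B a" "s \<in> B b" for r s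
        using that M by (auto simp: B_def additive_submonoid_def lookup_add add_mono)
      then have "{r + s | r s. r \<in> keys p \<and> s \<in> keys q} \<subseteq> B (a + b)"
        using that by blast
      then show ?thesis using keys_mult[of p q] by blast
    qed
    have B_one: "keys (1 :: ('v, 'k) mpolynomial) \<subseteq> B 0"
      using M by (simp add: B_def additive_submonoid_def)
    have B_power: "keys (x i ^ e) \<subseteq> B (e * D)" if "i < n" for i e
    proof (induction e)
      case (Suc e)
      have "keys (x i) \<subseteq> B D" using D[OF that] xM[OF that] by (auto simp: B_def)
      then show ?case using B_mult[OF _ Suc] by simp
    qed (use B_one in simp)
    have y_keys: "keys (y m) \<subseteq> B (n * (N * D))" if "m \<in> J" for m
    proof -
      have "keys (\<Prod>i<k. x i ^ m i) \<subseteq> B (k * (N * D))" if "k \<le> n" for k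
        using that
      proof (induction k)
        case (Suc k)
        have "m k \<le> N" using \<open>m \<in> J\<close> Suc.prems by (auto simp: J_def PiE_iff less_imp_le)
        then have "B (m k * D) \<subseteq> B (N * D)"
          by (auto simp: B_def intro: order_trans mult_le_mono1)
        then have "keys (x k ^ m k) \<subseteq> B (N * D)" using B_power[of k "m k"] Suc.prems by auto
        then show ?case using B_mult[OF Suc.IH] Suc.prems by (simp add: add.commute)
      qed (use B_one in simp)
      then show ?thesis unfolding y_def by blast
    qed

    have cardJ: "card J = N ^ n" by (simp add: J_def card_PiE)
    have "card (B (n * (N * D))) < card J"
    proof -
      have "card (B (n * (N * D))) \<le> Suc (n * (N * D)) ^ card W" by (rule cardB)
      also have "\<dots> \<le> (c0 * N) ^ card W"
        by (intro power_mono) (auto simp: c0_def N_def algebra_simps)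
      also have "\<dots> < N * N ^ card W"
        unfolding power_mult_distrib by (intro mult_strict_right_mono) (simp_all add: N_def)
      also have "\<dots> \<le> N ^ n"
        using n power_increasing[of "Suc (card W)" n N] by (simp add: N_def)
      finally show ?thesis by (simp add: cardJ)
    qed
    moreover have finJ: "finite J" by (simp add: J_def finite_PiE)
    ultimately obtain c :: "(nat \<Rightarrow> nat) \<Rightarrow> 'k" where c: "\<exists>m\<in>J. c m \<noteq> 0"
      and rel: "\<And>t. t \<in> B (n * (N * D)) \<Longrightarrow> (\<Sum>m\<in>J. c m * lookup (y m) t) = 0"
      using nontrivial_relation[OF finB finJ, of "n * (N * D)" "\<lambda>m. lookup (y m)"] by metis
    have scale: "lookup (Poly_Mapping.single 0 a * p) t = a * lookup p t"
      for a and p :: "('v, 'k) mpolynomial" and t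
      by (simp add: Poly_Mapping.map.rep_eq when_def flip: mult_map_scale_conv_mult)
    have "(\<Sum>m\<in>J. Poly_Mapping.single 0 (c m) * y m) = 0"
    proof (rule poly_mapping_eqI)
      fix t
      have "(\<Sum>m\<in>J. c m * lookup (y m) t) = 0"
      proof (cases "t \<in> B (n * (N * D))")
        case False
        then have "lookup (y m) t = 0" if "m \<in> J" for m
          using y_keys[OF that] by (auto simp: in_keys_iff)
        then show ?thesis by simp
      qed (rule rel)
      then show "lookup (\<Sum>m\<in>J. Poly_Mapping.single 0 (c m) * y m) t = lookup 0 t"
        by (simp add: lookup_sum scale)
    qed
    moreover have "0 \<in> C 0"
      using primeideal.axioms(1)[OF prime[of 0]] additive_subgroup.zero_closed[of "C 0" ?A]
      by (simp add: ideal_def)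
    ultimately have in_C0: "(\<Sum>m\<in>J. Poly_Mapping.single 0 (c m) * (\<Prod>i\<in>{0..<n}. x i ^ m i)) \<in> C 0"
      by (simp add: y_def lessThan_atLeast0)
    have "c m = 0" if "m \<in> J" for m
    proof (rule power_products_independent[OF M prime _ x _ finJ _ in_C0 that])
      show "C i \<subseteq> C (Suc i)" if "i < n" for i using strict[OF that] by blast
      show "m = m'" if "m \<in> J" "m' \<in> J" "\<And>i. 0 \<le> i \<Longrightarrow> i < n \<Longrightarrow> m i = m' i" for m m'
        using that unfolding J_def by (intro PiE_ext) auto
    qed simp_all
    then show False using c by blast
  qed
  then have "N \<le> enat (card W)"
    if "N \<in> {enat n | n. \<exists>C. (\<forall>i\<le>n. primeideal (C i) ?A) \<and> (\<forall>i<n. C i \<subset> C (Suc i))}" for N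
    using that by force
  then show ?thesis unfolding krull_dim_def by (intro Sup_least)
qed

section \<open>Krull dimension and ring homomorphisms\<close>

lemma krull_dim_surj_le:
  assumes A: "cring A" and B: "cring B" and h: "h \<in> ring_hom A B" and surj: "h ` carrier A = carrier B"
  shows "krull_dim B \<le> krull_dim A"
proof -
  interpret A: cring A by (rule A)
  interpret B: cring B by (rule B)
  interpret ring_hom_ring A B h by (rule ring_hom_ringI2[OF A.ring_axioms B.ring_axioms h])
  have "\<exists>C'. (\<forall>i\<le>n. primeideal (C' i) A) \<and> (\<forall>i<n. C' i \<subset> C' (Suc i))"
    if prime: "\<forall>i\<le>n. primeideal (C i) B" and strict: "\<forall>i<n. C i \<subset> C (Suc i)" for n and C :: "nat \<Rightarrow> 'c set"
  proof (intro exI[of _ "\<lambda>i. {r \<in> carrier A. h r \<in> C i}"] conjI allI impI)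
    show "primeideal {r \<in> carrier A. h r \<in> C i} A" if "i \<le> n" for i
      using primeideal_vimage[OF A] prime that by blast
    show "{r \<in> carrier A. h r \<in> C i} \<subset> {r \<in> carrier A. h r \<in> C (Suc i)}" if i: "i < n" for i
    proof -
      obtain b where b: "b \<in> C (Suc i)" "b \<notin> C i" using strict i by blast
      have "ideal (C (Suc i)) B" using prime i by (simp add: primeideal_def)
      then have "b \<in> carrier B" using b(1) by (rule ideal.Icarr)
      then obtain r where "r \<in> carrier A" "b = h r" using surj by blast
      then show ?thesis using b strict i by blast
    qed
  qed
  then show ?thesis unfolding krull_dim_def by (intro Sup_subset_mono) blast
qed

lemma krull_dim_ring_iso:
  assumes A: "cring A" and h: "h \<in> ring_iso A B" and zero: "h \<zero>\<^bsub>A\<^esub> = \<zero>\<^bsub>B\<^esub>"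
  shows "krull_dim B = krull_dim A"
proof -
  have B: "cring B" using cring.ring_iso_imp_img_cring[OF A h] zero by simp
  have h': "inv_into (carrier A) h \<in> ring_iso B A"
    using ring_iso_set_sym[OF _ h] A by (simp add: cring_def)
  have "krull_dim B \<le> krull_dim A"
    using h by (intro krull_dim_surj_le[OF A B, of h]) (auto simp: ring_iso_def bij_betw_def)
  moreover have "krull_dim A \<le> krull_dim B"
    using h' by (intro krull_dim_surj_le[OF B A, of "inv_into (carrier A) h"]) (auto simp: ring_iso_def bij_betw_def)
  ultimately show ?thesis by (rule order_antisym)
qed

section \<open>Ideals generated by monomials\<close>

lemma monomial_span_induct [consumes 1, case_names zero add single]:
  assumes p: "p \<in> monomial_span D"
    and "P 0" and "\<And>p q. P p \<Longrightarrow> P q \<Longrightarrow> P (p + q)"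
    and "\<And>t c. t \<in> D \<Longrightarrow> P (Poly_Mapping.single t (c :: 'k::comm_monoid_add))"
  shows "P p"
proof -
  have "P (\<Sum>t\<in>K. Poly_Mapping.single t (lookup p t))" if "finite K" "K \<subseteq> D" for K
    using that by (induction K rule: finite_induct) (use assms(2-4) in auto)
  from this[of "keys p"] show ?thesis
    using p poly_mapping_sum_single[of "keys p" p] by (simp add: monomial_span_def)
qed

lemma single_in_monomial_span: "t \<in> D \<Longrightarrow> Poly_Mapping.single t c \<in> monomial_span D"
  by (simp add: monomial_span_def)

lemma ideal_prod_monomial_span:
  "ideal_prod (monoid_algebra M) (monomial_span D) (monomial_span D') =
     (monomial_span (D + D') :: ('t::comm_monoid_add \<Rightarrow>\<^sub>0 'k::field) set)"
proof (intro equalityI subsetI)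
  fix p :: "'t \<Rightarrow>\<^sub>0 'k"
  assume "p \<in> ideal_prod (monoid_algebra M) (monomial_span D) (monomial_span D')"
  then show "p \<in> monomial_span (D + D')"
    by (induction p rule: ideal_prod.induct) (simp_all add: monomial_span_mult monomial_span_add)
next
  fix p :: "'t \<Rightarrow>\<^sub>0 'k"
  assume "p \<in> monomial_span (D + D')"
  then show "p \<in> ideal_prod (monoid_algebra M) (monomial_span D) (monomial_span D')"
  proof (induction p rule: monomial_span_induct)
    case zero
    have "(0 :: 't \<Rightarrow>\<^sub>0 'k) \<in> monomial_span D" for D by (simp add: monomial_span_def)
    then show ?case using ideal_prod.prod[of "0 :: 't \<Rightarrow>\<^sub>0 'k" "monomial_span D" 0 "monomial_span D'" "monoid_algebra M"] by simp
  next
    case (add p q)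
    then show ?case using ideal_prod.sum[of p "monoid_algebra M" _ _ q] by simp
  next
    case (single t c)
    then obtain s s' where t: "t = s + s'" "s \<in> D" "s' \<in> D'" by (auto elim: set_plus_elim)
    then show ?case
      using ideal_prod.prod[of "Poly_Mapping.single s c" "monomial_span D" "Poly_Mapping.single s' 1"
          "monomial_span D'" "monoid_algebra M"]
      by (simp add: single_in_monomial_span mult_single)
  qed
qed

lemma additive_submonoid_plus_self: "additive_submonoid M \<Longrightarrow> M + M = M"
  by (force simp: additive_submonoid_def elim!: set_plus_elim intro: set_plus_intro[of 0 _ _ M, simplified])

lemma genideal_monomials:
  assumes M: "additive_submonoid M" and T: "T \<subseteq> M"
  shows "Idl\<^bsub>monoid_algebra M\<^esub> ((\<lambda>t. Poly_Mapping.single t 1) ` T) =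
     (monomial_span (T + M) :: ('t::comm_monoid_add \<Rightarrow>\<^sub>0 'k::field) set)"
proof -
  let ?A = "monoid_algebra M :: ('t \<Rightarrow>\<^sub>0 'k) ring"
  let ?T = "(\<lambda>t. Poly_Mapping.single t 1) ` T :: ('t \<Rightarrow>\<^sub>0 'k) set"
  interpret cring ?A by (rule cring_monoid_algebra[OF M])
  have M0: "0 \<in> M" using M by (simp add: additive_submonoid_def)
  have TM: "T + M \<subseteq> M" using M T by (auto simp: additive_submonoid_def elim!: set_plus_elim)
  have "ideal (monomial_span (T + M)) ?A"
    using TM by (intro ideal_monomial_span[OF M]) (simp_all add: add.assoc additive_submonoid_plus_self[OF M])
  moreover have "?T \<subseteq> monomial_span (T + M)"
    using set_plus_intro[OF _ M0, of _ T] by (auto intro!: single_in_monomial_span)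
  ultimately have "Idl\<^bsub>?A\<^esub> ?T \<subseteq> monomial_span (T + M)" by (rule genideal_minimal)
  moreover have "p \<in> Idl\<^bsub>?A\<^esub> ?T" if "p \<in> monomial_span (T + M)" for p
  proof -
    have sub: "?T \<subseteq> carrier ?A" using T by auto
    interpret I: ideal "Idl\<^bsub>?A\<^esub> ?T" ?A by (rule genideal_ideal[OF sub])
    show ?thesis using that
    proof (induction p rule: monomial_span_induct)
      case zero
      show ?case using I.zero_closed by simp
    next
      case (add p q)
      then show ?case using I.a_closed[of p q] by simp
    next
      case (single t c)
      then obtain s r where t: "t = s + r" "s \<in> T" "r \<in> M" by (auto elim: set_plus_elim)
      have "Poly_Mapping.single s 1 \<in> Idl\<^bsub>?A\<^esub> ?T" using genideal_self[OF sub] t by auto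
      then show ?case
        using I.I_r_closed[of "Poly_Mapping.single s 1" "Poly_Mapping.single r c"] t by (simp add: mult_single)
    qed
  qed
  ultimately show ?thesis by blast
qed

text \<open>The exponents of the products of \<open>n\<close> monomials with exponents in \<open>G\<close>; the sum of sets is the
  pointwise one.\<close>

definition nfold_sums :: "'t::comm_monoid_add set \<Rightarrow> nat \<Rightarrow> 't set"
  where "nfold_sums G n = (((+) G) ^^ n) {0}"

lemma nfold_sums_0: "nfold_sums G 0 = {0}"
  and nfold_sums_Suc: "nfold_sums G (Suc n) = G + nfold_sums G n"
  by (simp_all add: nfold_sums_def)

lemma nfold_sums_induct [consumes 1, case_names zero add]:
  assumes "t \<in> (\<Union>n. nfold_sums G n)" and "P 0" and "\<And>g t. g \<in> G \<Longrightarrow> P t \<Longrightarrow> P (g + t)"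
  shows "P t"
proof -
  have "P t" if "t \<in> nfold_sums G n" for n t
    using that
    by (induction n arbitrary: t) (auto simp: nfold_sums_0 nfold_sums_Suc assms(2,3) elim!: set_plus_elim)
  then show ?thesis using assms(1) by blast
qed

lemma gens_in_nfold_sums: "g \<in> G \<Longrightarrow> g \<in> (\<Union>n. nfold_sums G n)"
  by (intro UN_I[of 1]) (simp_all add: nfold_sums_def set_plus_def)

lemma nfold_sums_add: "nfold_sums G (m + n) = nfold_sums G m + nfold_sums G n"
  by (induction m) (simp_all add: nfold_sums_0 nfold_sums_Suc add.assoc)

lemma nfold_sums_subset: "additive_submonoid M \<Longrightarrow> G \<subseteq> M \<Longrightarrow> nfold_sums G n \<subseteq> M"
  by (induction n) (auto simp: nfold_sums_0 nfold_sums_Suc additive_submonoid_def elim!: set_plus_elim)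

lemma additive_submonoid_nfold_sums: "additive_submonoid (\<Union>n. nfold_sums G n)"
  unfolding additive_submonoid_def
proof (intro conjI ballI)
  show "0 \<in> (\<Union>n. nfold_sums G n)" using nfold_sums_0[of G] by blast
  fix s t assume "s \<in> (\<Union>n. nfold_sums G n)" "t \<in> (\<Union>n. nfold_sums G n)"
  then obtain m n where "s \<in> nfold_sums G m" "t \<in> nfold_sums G n" by blast
  then have "s + t \<in> nfold_sums G (m + n)" by (simp add: nfold_sums_add set_plus_intro)
  then show "s + t \<in> (\<Union>n. nfold_sums G n)" by blast
qed

lemma ideal_pow_monomial_span:
  assumes M: "additive_submonoid M" and G: "G \<subseteq> M"
  shows "ideal_pow (monoid_algebra M) (monomial_span (G + M)) n =
           (monomial_span (nfold_sums G n + M) :: ('t::comm_monoid_add \<Rightarrow>\<^sub>0 'k::field) set)"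
proof (induction n)
  case 0
  have "{0} + M = M" by (simp add: set_plus_def)
  then show ?case
    by (auto simp: ideal_pow_def ideals_set_def nfold_sums_0 monomial_span_def)
next
  case (Suc n)
  let ?A = "monoid_algebra M :: ('t \<Rightarrow>\<^sub>0 'k) ring"
  have "ideal_pow ?A (monomial_span (G + M)) (Suc n) =
      ideal_prod ?A (ideal_pow ?A (monomial_span (G + M)) n) (monomial_span (G + M))"
    by (simp add: ideal_pow_def ideals_set_def)
  also have "\<dots> = monomial_span (nfold_sums G n + M + (G + M))"
    by (simp add: Suc ideal_prod_monomial_span)
  also have "nfold_sums G n + M + (G + M) = G + nfold_sums G n + (M + M)"
    by (simp add: ac_simps)
  finally show ?case by (simp add: nfold_sums_Suc additive_submonoid_plus_self[OF M])
qed

section \<open>Special fiber rings of equigenerated monomial ideals\<close>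

definition total_degree :: "('v \<Rightarrow>\<^sub>0 nat) \<Rightarrow> nat"
  where "total_degree t = (\<Sum>v\<in>keys t. lookup t v)"

lemma total_degree_superset:
  "finite K \<Longrightarrow> keys t \<subseteq> K \<Longrightarrow> total_degree t = (\<Sum>v\<in>K. lookup t v)"
  unfolding total_degree_def by (intro sum.mono_neutral_left) (auto simp: in_keys_iff)

lemma total_degree_add: "total_degree (s + t) = total_degree s + total_degree t"
proof -
  have "keys (s + t) \<subseteq> keys s \<union> keys t" by (rule Poly_Mapping.keys_add)
  then show ?thesis
    by (simp add: total_degree_superset[of "keys s \<union> keys t"] lookup_add sum.distrib)
qed

lemma total_degree_0 [simp]: "total_degree 0 = 0"
  and total_degree_single [simp]: "total_degree (Poly_Mapping.single v n) = n"
  by (simp_all add: total_degree_def)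

lemma mpoly_ring_eq: "mpoly_ring V = monoid_algebra {t. keys t \<subseteq> V}"
  by (auto simp: mpoly_ring_def monoid_algebra_def)

lemma monomial_span_coset:
  "monomial_span D +>\<^bsub>monoid_algebra M\<^esub> (x :: 't::comm_monoid_add \<Rightarrow>\<^sub>0 'k::field) = {h + x | h. h \<in> monomial_span D}"
  by (auto simp: a_r_coset_def')

lemma monomial_span_coset_eq_iff:
  fixes x y :: "'t::comm_monoid_add \<Rightarrow>\<^sub>0 'k::field"
  shows "monomial_span D +>\<^bsub>monoid_algebra M\<^esub> x = monomial_span D +>\<^bsub>monoid_algebra M\<^esub> y \<longleftrightarrow>
    x - y \<in> monomial_span D"
proof
  assume "monomial_span D +>\<^bsub>monoid_algebra M\<^esub> x = monomial_span D +>\<^bsub>monoid_algebra M\<^esub> y"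
  moreover have "x \<in> monomial_span D +>\<^bsub>monoid_algebra M\<^esub> x"
    unfolding monomial_span_coset by (auto intro!: exI[of _ 0] simp: monomial_span_def)
  ultimately show "x - y \<in> monomial_span D" by (auto simp: monomial_span_coset)
next
  have *: "monomial_span D +>\<^bsub>monoid_algebra M\<^esub> x \<subseteq> monomial_span D +>\<^bsub>monoid_algebra M\<^esub> y"
    if "x - y \<in> monomial_span D" for x y :: "'t \<Rightarrow>\<^sub>0 'k"
  proof
    fix z assume "z \<in> monomial_span D +>\<^bsub>monoid_algebra M\<^esub> x"
    then obtain h where h: "h \<in> monomial_span D" "z = h + x" by (auto simp: monomial_span_coset)
    then have "z = (h + (x - y)) + y" "h + (x - y) \<in> monomial_span D"
      using monomial_span_add[OF h(1) that] by simp_all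
    then show "z \<in> monomial_span D +>\<^bsub>monoid_algebra M\<^esub> y" unfolding monomial_span_coset by blast
  qed
  assume "x - y \<in> monomial_span D"
  moreover from monomial_span_uminus[OF this] have "y - x \<in> monomial_span D" by simp
  ultimately show "monomial_span D +>\<^bsub>monoid_algebra M\<^esub> x = monomial_span D +>\<^bsub>monoid_algebra M\<^esub> y"
    using * by blast
qed

lemma finsum_monoid_algebra:
  assumes M: "additive_submonoid M" and "finite A" and "\<And>i. i \<in> A \<Longrightarrow> keys (f i) \<subseteq> M"
  shows "finsum (monoid_algebra M) f A = (\<Sum>i\<in>A. f i :: 't::comm_monoid_add \<Rightarrow>\<^sub>0 'k::field)"
proof -
  interpret cring "monoid_algebra M :: ('t \<Rightarrow>\<^sub>0 'k) ring" by (rule cring_monoid_algebra[OF M])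
  show ?thesis
    using assms(2,3)
  proof (induction A rule: finite_induct)
    case (insert a A)
    then show ?case by (subst finsum_insert) auto
  qed simp
qed

text \<open>Generators of one common degree.  The monomials of degree \<open>n * \<delta>\<close> in \<open>I\<^sup>n\<close> are then exactly the
  \<open>n\<close>-fold products of generators, and every other monomial of \<open>I\<^sup>n\<close> is a proper multiple of one of these and
  so lies in \<open>\<mm> I\<^sup>n\<close>.\<close>

locale equigenerated =
  fixes V :: "'v set" and G :: "('v \<Rightarrow>\<^sub>0 nat) set" and \<delta> :: nat
  assumes gens_vars: "g \<in> G \<Longrightarrow> keys g \<subseteq> V"
    and gens_degree: "g \<in> G \<Longrightarrow> total_degree g = \<delta>"
    and degree_pos: "\<delta> > 0"
begin

abbreviation "exps \<equiv> {t :: 'v \<Rightarrow>\<^sub>0 nat. keys t \<subseteq> V}"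

abbreviation "vars \<equiv> (\<lambda>v. Poly_Mapping.single v (1::nat)) ` V"

abbreviation "piece \<equiv> nfold_sums G"

abbreviation "fiber_monoid \<equiv> \<Union>n. piece n"

text \<open>The exponents of the monomials in \<open>\<mm> I\<^sup>n\<close>.\<close>

definition "killed n = vars + exps + (piece n + exps)"

lemma submonoid_exps: "additive_submonoid exps"
proof -
  have "keys (s + t) \<subseteq> V" if "keys s \<subseteq> V" "keys t \<subseteq> V" for s t :: "'v \<Rightarrow>\<^sub>0 nat"
    using that Poly_Mapping.keys_add[of s t] by blast
  then show ?thesis by (simp add: additive_submonoid_def)
qed

lemma gens_subset: "G \<subseteq> exps"
  using gens_vars by blast

lemma piece_subset: "piece n \<subseteq> exps"
  by (rule nfold_sums_subset[OF submonoid_exps gens_subset])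

lemma degree_piece: "t \<in> piece n \<Longrightarrow> total_degree t = n * \<delta>"
  by (induction n arbitrary: t)
     (auto simp: nfold_sums_0 nfold_sums_Suc total_degree_add gens_degree elim!: set_plus_elim)

lemma piece_disjoint: "t \<in> piece m \<Longrightarrow> t \<in> piece n \<Longrightarrow> m = n"
  using degree_piece[of t m] degree_piece[of t n] degree_pos by simp

text \<open>A proper multiple of an \<open>n\<close>-fold product of generators has degree above \<open>n * \<delta>\<close>.\<close>

lemma piece_not_killed:
  assumes "t \<in> piece n"
  shows "t \<notin> killed n"
proof
  assume "t \<in> killed n"
  then obtain v r s r' where "t = (Poly_Mapping.single v 1 + r) + (s + r')" "s \<in> piece n"
    by (auto simp: killed_def elim!: set_plus_elim)
  then have "total_degree t > n * \<delta>" by (simp add: total_degree_add degree_piece)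
  then show False using degree_piece[OF assms] by simp
qed

lemma killed_if_not_piece:
  assumes "t \<in> piece n + exps" "t \<notin> piece n"
  shows "t \<in> killed n"
proof -
  obtain s r where t: "t = s + r" "s \<in> piece n" "r \<in> exps"
    using assms(1) by (auto elim: set_plus_elim)
  then have "r \<noteq> 0" using assms(2) by auto
  then obtain v where v: "v \<in> keys r" by (metis all_not_in_conv Poly_Mapping.keys_eq_empty)
  have r: "r = Poly_Mapping.single v 1 + (r - Poly_Mapping.single v 1)"
    using v by (intro poly_mapping_eqI) (auto simp: lookup_add lookup_minus lookup_single when_def in_keys_iff)
  have "keys (r - Poly_Mapping.single v 1) \<subseteq> keys r"
    by (auto simp: in_keys_iff lookup_minus)
  then have "Poly_Mapping.single v 1 + (r - Poly_Mapping.single v 1) + (s + 0) \<in> killed n"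
    unfolding killed_def using t v by (intro set_plus_intro) auto
  then show ?thesis using r t by (simp add: add.commute)
qed

lemma killed_ideal: "killed n \<subseteq> exps" "killed n + exps \<subseteq> killed n"
proof -
  show "killed n \<subseteq> exps"
  proof
    have add: "s + t \<in> exps" if "s \<in> exps" "t \<in> exps" for s t
      using submonoid_exps that by (simp add: additive_submonoid_def)
    fix t assume "t \<in> killed n"
    then obtain u r s r' where t: "t = (u + r) + (s + r')"
      and mem: "u \<in> vars" "r \<in> exps" "s \<in> piece n" "r' \<in> exps"
      unfolding killed_def by (elim set_plus_elim) blast
    have "u \<in> exps" using mem(1) by auto
    moreover have "s \<in> exps" using mem(3) piece_subset by blast
    ultimately show "t \<in> exps" unfolding t using mem(2,4) by (intro add)
  qed
  have "killed n + exps = vars + exps + (piece n + (exps + exps))"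
    by (simp add: killed_def add.assoc)
  then show "killed n + exps \<subseteq> killed n"
    by (simp add: killed_def additive_submonoid_plus_self[OF submonoid_exps])
qed

lemma bounded_degree:
  assumes "keys p \<subseteq> fiber_monoid"
  obtains K where "\<And>t i. t \<in> keys p \<Longrightarrow> t \<in> piece i \<Longrightarrow> i \<le> K"
proof -
  obtain K where K: "\<forall>d\<in>total_degree ` keys p. d \<le> K"
    using finite_nat_set_iff_bounded_le[of "total_degree ` keys p"] by auto
  have "i \<le> K" if "t \<in> keys p" "t \<in> piece i" for t i
  proof -
    have "i \<le> i * \<delta>" using degree_pos by simp
    also have "\<dots> \<le> K" using K that degree_piece[of t i] by auto
    finally show ?thesis .
  qed
  then show thesis using that by blast
qed

lemma sum_parts:
  assumes "keys p \<subseteq> fiber_monoid" "\<And>t i. t \<in> keys p \<Longrightarrow> t \<in> piece i \<Longrightarrow> i \<le> K"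
  shows "p = (\<Sum>i\<le>K. part (piece i) (p :: _ \<Rightarrow>\<^sub>0 'k::comm_monoid_add))"
proof (rule poly_mapping_eqI)
  fix t
  show "lookup p t = lookup (\<Sum>i\<le>K. part (piece i) p) t"
  proof (cases "t \<in> keys p")
    case True
    then obtain i where i: "t \<in> piece i" "i \<le> K" using assms by blast
    then have "t \<in> piece j \<longleftrightarrow> j = i" for j using piece_disjoint by blast
    then show ?thesis using i by (simp add: lookup_sum lookup_part)
  next
    case False
    then have "lookup p t = 0" by (simp add: in_keys_iff)
    then show ?thesis by (simp add: lookup_sum lookup_part cong: if_cong)
  qed
qed

text \<open>The pieces grade the monoid algebra: they are disjoint, and a product of elements from pieces \<open>i\<close>
  and \<open>j\<close> lies in piece \<open>i + j\<close>.\<close>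

lemma part_mult:
  fixes p q :: "('v, 'k::field) mpolynomial"
  assumes p: "keys p \<subseteq> fiber_monoid" and q: "keys q \<subseteq> fiber_monoid"
  shows "part (piece n) (p * q) = (\<Sum>i\<le>n. part (piece i) p * part (piece (n - i)) q)"
proof -
  obtain K1 where K1: "\<And>t i. t \<in> keys p \<Longrightarrow> t \<in> piece i \<Longrightarrow> i \<le> K1" using bounded_degree[OF p] by blast
  obtain K2 where K2: "\<And>t i. t \<in> keys q \<Longrightarrow> t \<in> piece i \<Longrightarrow> i \<le> K2" using bounded_degree[OF q] by blast
  define K where "K = max n (max K1 K2)"
  have "p = (\<Sum>i\<le>K. part (piece i) p)" "q = (\<Sum>j\<le>K. part (piece j) q)"
    using K1 K2 by (intro sum_parts p q; force simp: K_def)+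
  then have "p * q = (\<Sum>i\<le>K. part (piece i) p) * (\<Sum>j\<le>K. part (piece j) q)" by simp
  then have "part (piece n) (p * q) = (\<Sum>i\<le>K. \<Sum>j\<le>K. part (piece n) (part (piece i) p * part (piece j) q))"
    by (simp add: sum_product part_sum)
  also have "\<dots> = (\<Sum>i\<le>K. \<Sum>j\<le>K. if j = n - i \<and> i \<le> n then part (piece i) p * part (piece j) q else 0)"
  proof (intro sum.cong refl)
    fix i j
    have "part (piece i) p \<in> monomial_span (piece i)" "part (piece j) q \<in> monomial_span (piece j)"
      by (simp_all add: monomial_span_def keys_part)
    then have "part (piece i) p * part (piece j) q \<in> monomial_span (piece (i + j))"
      unfolding nfold_sums_add by (rule monomial_span_mult)
    then have *: "keys (part (piece i) p * part (piece j) q) \<subseteq> piece (i + j)"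
      by (simp add: monomial_span_def)
    show "part (piece n) (part (piece i) p * part (piece j) q) =
        (if j = n - i \<and> i \<le> n then part (piece i) p * part (piece j) q else 0)"
    proof (cases "i + j = n")
      case True
      with * show ?thesis by (auto intro: part_eq_self)
    next
      case False
      then have "piece (i + j) \<inter> piece n = {}" using piece_disjoint by blast
      with * have "keys (part (piece i) p * part (piece j) q) \<inter> piece n = {}" by blast
      then show ?thesis using False by (auto simp: part_eq_0)
    qed
  qed
  also have "\<dots> = (\<Sum>i\<le>K. if i \<le> n then part (piece i) p * part (piece (n - i)) q else 0)"
    by (intro sum.cong refl) (auto simp: K_def)
  also have "\<dots> = (\<Sum>i\<le>n. part (piece i) p * part (piece (n - i)) q)"
    by (intro sum.mono_neutral_cong_right) (auto simp: K_def)
  finally show ?thesis .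
qed

context
  fixes I :: "('v, 'k::field) mpolynomial set"
  assumes I: "I = Idl\<^bsub>mpoly_ring V\<^esub> ((\<lambda>t. Poly_Mapping.single t 1) ` G)"
begin

abbreviation "S \<equiv> mpoly_ring V :: ('v, 'k) mpolynomial ring"
abbreviation "\<mm> \<equiv> homogeneous_max_ideal V :: ('v, 'k) mpolynomial set"
abbreviation "den \<equiv> fiber_den S \<mm> I"

lemma ideal_pow_eq: "ideal_pow S I n = monomial_span (piece n + exps)"
  unfolding I mpoly_ring_eq genideal_monomials[OF submonoid_exps gens_subset]
  by (rule ideal_pow_monomial_span[OF submonoid_exps gens_subset])

lemma den_eq: "den n = monomial_span (killed n)"
proof -
  have "\<mm> = Idl\<^bsub>monoid_algebra exps\<^esub> ((\<lambda>t. Poly_Mapping.single t 1) ` vars)"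
    by (simp add: homogeneous_max_ideal_def mpoly_ring_eq mvar_def image_image)
  also have "\<dots> = monomial_span (vars + exps)"
    by (intro genideal_monomials submonoid_exps) auto
  finally show ?thesis
    unfolding fiber_den_def ideal_pow_eq by (simp add: mpoly_ring_eq ideal_prod_monomial_span killed_def)
qed

lemma cring_S: "cring S"
  by (rule cring_mpoly_ring)

lemma ideal_I: "ideal I S"
  unfolding I using gens_subset cring_S
  by (intro ring.genideal_ideal) (auto simp: cring_def mpoly_ring_eq)

lemma ideal_max: "ideal \<mm> S"
  unfolding homogeneous_max_ideal_def using cring_S
  by (intro ring.genideal_ideal) (auto simp: cring_def mpoly_ring_eq mvar_def)

lemma ideal_den: "ideal (den n) S"
  unfolding den_eq unfolding mpoly_ring_eq by (intro ideal_monomial_span submonoid_exps killed_ideal)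

lemma coset_eq_iff: "den n +>\<^bsub>S\<^esub> x = den n +>\<^bsub>S\<^esub> y \<longleftrightarrow> x - y \<in> den n"
  unfolding den_eq unfolding mpoly_ring_eq by (rule monomial_span_coset_eq_iff)

lemma coset_zero: "den n +>\<^bsub>S\<^esub> 0 = den n"
  unfolding den_eq unfolding mpoly_ring_eq monomial_span_coset by simp

lemma part_in_den_iff: "part (piece n) p \<in> den n \<longleftrightarrow> part (piece n) p = 0"
proof
  assume "part (piece n) p \<in> den n"
  then have "keys (part (piece n) p) \<subseteq> killed n \<inter> piece n"
    by (auto simp: den_eq monomial_span_def keys_part)
  then have "keys (part (piece n) p) = {}" using piece_not_killed by blast
  then show "part (piece n) p = 0" by (simp add: Poly_Mapping.keys_eq_empty)
qed (simp add: den_eq monomial_span_def)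

text \<open>Every class in \<open>I\<^sup>n / \<mm> I\<^sup>n\<close> has a representative spanned by \<open>n\<close>-fold products of generators;
  it is unique because no such product lies in \<open>\<mm> I\<^sup>n\<close>.\<close>

lemma part_coset_eq:
  assumes "x \<in> ideal_pow S I n"
  shows "den n +>\<^bsub>S\<^esub> part (piece n) x = den n +>\<^bsub>S\<^esub> x"
proof -
  have "t \<in> killed n" if "t \<in> keys (part (piece n) x - x)" for t
  proof (rule killed_if_not_piece)
    have "t \<in> keys x \<and> t \<notin> piece n"
      using that by (auto simp: in_keys_iff lookup_minus lookup_part split: if_splits)
    then show "t \<in> piece n + exps" "t \<notin> piece n"
      using assms by (auto simp: ideal_pow_eq monomial_span_def)
  qed
  then show ?thesis unfolding coset_eq_iff unfolding den_eq by (auto simp: monomial_span_def)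
qed

lemma part_in_ideal_pow: "part (piece n) x \<in> ideal_pow S I n"
proof -
  have "piece n \<subseteq> piece n + exps" using set_plus_intro[of _ "piece n" 0 exps] by auto
  then show ?thesis by (auto simp: ideal_pow_eq monomial_span_def keys_part)
qed

lemma part_in_carrier: "part (piece n) x \<in> carrier S"
  using piece_subset[of n] by (auto simp: mpoly_ring_eq keys_part)

definition fiber_class :: "('v, 'k) mpolynomial \<Rightarrow> nat \<Rightarrow> ('v, 'k) mpolynomial set"
  where "fiber_class p = (\<lambda>n. den n +>\<^bsub>S\<^esub> part (piece n) p)"

lemma fiber_class_mult:
  assumes p: "keys p \<subseteq> fiber_monoid" and q: "keys q \<subseteq> fiber_monoid"
  shows "fiber_class (p * q) n =
    finsum (S Quot den n) (\<lambda>i. rcoset_mult S (den n) (fiber_class p i) (fiber_class q (n - i))) {..n}"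
proof -
  interpret S: cring S by (rule cring_S)
  interpret D: ideal "den n" S by (rule ideal_den)
  interpret h: ring_hom_cring S "S Quot den n" "(+>\<^bsub>S\<^esub>) (den n)"
    by (rule D.rcos_ring_hom_cring[OF cring_S])
  let ?f = "\<lambda>i. part (piece i) p * part (piece (n - i)) q"
  have f: "?f i \<in> carrier S" for i
    using S.m_closed[OF part_in_carrier[of i p] part_in_carrier[of "n - i" q]] by (simp add: mpoly_ring_def)
  have "rcoset_mult S (den n) (fiber_class p i) (fiber_class q (n - i)) = den n +>\<^bsub>S\<^esub> ?f i" if "i \<le> n" for i
    using rcoset_mult_fiber_den[OF cring_S ideal_max ideal_I part_in_ideal_pow[of i p]
        part_in_ideal_pow[of "n - i" q]] that
    by (simp add: fiber_class_def mpoly_ring_eq)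
  then have "finsum (S Quot den n) (\<lambda>i. rcoset_mult S (den n) (fiber_class p i) (fiber_class q (n - i))) {..n} =
      finsum (S Quot den n) ((+>\<^bsub>S\<^esub>) (den n) \<circ> ?f) {..n}"
    using f by (intro h.S.finsum_cong') auto
  also have "\<dots> = den n +>\<^bsub>S\<^esub> finsum S ?f {..n}"
    using f by (subst h.hom_finsum) auto
  also have "finsum S ?f {..n} = (\<Sum>i\<le>n. ?f i)"
    using f unfolding mpoly_ring_eq by (intro finsum_monoid_algebra submonoid_exps) auto
  finally show ?thesis by (simp add: fiber_class_def part_mult[OF p q])
qed

text \<open>Both rings are graded, and in degree \<open>n\<close> the map sends an element to its class modulo \<open>\<mm> I\<^sup>n\<close>.
  Bijectivity holds degree by degree, by existence and uniqueness of representatives spanned by \<open>n\<close>-fold products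
  of generators.\<close>

lemma fiber_class_iso:
  "fiber_class \<in> ring_iso (monoid_algebra fiber_monoid) (special_fiber_ring S \<mm> I)"
proof (rule ring_iso_memI)
  let ?F = "special_fiber_ring S \<mm> I" and ?A = "monoid_algebra fiber_monoid :: ('v, 'k) mpolynomial ring"
  show "fiber_class p \<in> carrier ?F" if "p \<in> carrier ?A" for p
  proof -
    obtain K where K: "\<And>t i. t \<in> keys p \<Longrightarrow> t \<in> piece i \<Longrightarrow> i \<le> K"
      using bounded_degree[of p] \<open>p \<in> carrier ?A\<close> by auto
    have "n \<le> K" if "fiber_class p n \<noteq> den n" for n
    proof (rule ccontr)
      assume "\<not> n \<le> K"
      then have "part (piece n) p = 0" using K by (intro part_eq_0) blast
      then show False using that coset_zero by (simp add: fiber_class_def)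
    qed
    then have "finite {n. fiber_class p n \<noteq> den n}"
      by (intro finite_subset[OF _ finite_atMost[of K]]) auto
    then show ?thesis
      using part_in_ideal_pow by (auto simp: special_fiber_ring_def fiber_class_def)
  qed
  show "fiber_class (p \<otimes>\<^bsub>?A\<^esub> q) = fiber_class p \<otimes>\<^bsub>?F\<^esub> fiber_class q"
    if "p \<in> carrier ?A" "q \<in> carrier ?A" for p q
    using fiber_class_mult[of p q] that by (simp add: special_fiber_ring_def fun_eq_iff)
  show "fiber_class (p \<oplus>\<^bsub>?A\<^esub> q) = fiber_class p \<oplus>\<^bsub>?F\<^esub> fiber_class q"
    if "p \<in> carrier ?A" "q \<in> carrier ?A" for p q
  proof
    fix n
    have "(den n +>\<^bsub>S\<^esub> part (piece n) p) <+>\<^bsub>S\<^esub> (den n +>\<^bsub>S\<^esub> part (piece n) q) =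
        den n +>\<^bsub>S\<^esub> (part (piece n) p \<oplus>\<^bsub>S\<^esub> part (piece n) q)"
      by (intro abelian_subgroup.a_rcos_sum[OF abelian_subgroupI3] part_in_carrier
          ideal.axioms(1)[OF ideal_den] ring.is_abelian_group cring.axioms(1)[OF cring_S])
    then show "fiber_class (p \<oplus>\<^bsub>?A\<^esub> q) n = (fiber_class p \<oplus>\<^bsub>?F\<^esub> fiber_class q) n"
      by (simp add: special_fiber_ring_def fiber_class_def part_add) (simp add: mpoly_ring_eq)
  qed
  show "fiber_class \<one>\<^bsub>?A\<^esub> = \<one>\<^bsub>?F\<^esub>"
  proof
    fix n
    have "0 \<in> piece n \<longleftrightarrow> n = 0" using degree_piece[of 0 n] degree_pos by (auto simp: nfold_sums_0)
    then have "part (piece n) 1 = (if n = 0 then 1 else 0 :: ('v, 'k) mpolynomial)"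
      by (auto intro: part_eq_self part_eq_0)
    then show "fiber_class \<one>\<^bsub>?A\<^esub> n = \<one>\<^bsub>?F\<^esub> n"
      by (simp add: special_fiber_ring_def fiber_class_def coset_zero) (simp add: mpoly_ring_eq)
  qed
  have "inj_on fiber_class (carrier ?A)"
  proof (rule inj_onI)
    fix p q assume pq: "p \<in> carrier ?A" "q \<in> carrier ?A" and eq: "fiber_class p = fiber_class q"
    have "part (piece n) p = part (piece n) q" for n
    proof -
      have "part (piece n) p - part (piece n) q = part (piece n) (p - q)"
        by (rule poly_mapping_eqI) (simp add: lookup_part lookup_minus)
      moreover have "part (piece n) p - part (piece n) q \<in> den n"
        using fun_cong[OF eq, of n] by (simp add: fiber_class_def coset_eq_iff)
      ultimately show ?thesis using part_in_den_iff[of n "p - q"] by simp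
    qed
    then have "lookup p t = lookup q t" if "t \<in> fiber_monoid" for t
      using that by (metis UN_E lookup_part)
    moreover have "lookup p t = lookup q t" if "t \<notin> fiber_monoid" for t
      using pq that by (simp add: subset_iff in_keys_iff) metis
    ultimately show "p = q" by (intro poly_mapping_eqI) blast
  qed
  moreover have "f \<in> fiber_class ` carrier ?A" if f: "f \<in> carrier ?F" for f
  proof -
    have "\<forall>n. \<exists>x. x \<in> ideal_pow S I n \<and> f n = den n +>\<^bsub>S\<^esub> x" and fin: "finite {n. f n \<noteq> den n}"
      using f by (auto simp: special_fiber_ring_def)
    then obtain x where x: "\<And>n. x n \<in> ideal_pow S I n" "\<And>n. f n = den n +>\<^bsub>S\<^esub> x n" by metis
    define y where "y n = part (piece n) (x n)" for n
    have fy: "f n = den n +>\<^bsub>S\<^esub> y n" for n using part_coset_eq x by (simp add: y_def)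
    have y0: "y n = 0" if "f n = den n" for n
    proof -
      have "den n +>\<^bsub>S\<^esub> y n = den n +>\<^bsub>S\<^esub> 0" using that fy coset_zero by simp
      then show ?thesis using part_in_den_iff unfolding coset_eq_iff y_def by simp
    qed
    define p where "p = (\<Sum>n\<in>{n. f n \<noteq> den n}. y n)"
    have ysub: "keys (y n) \<subseteq> piece n" for n by (simp add: y_def keys_part)
    have "part (piece n) p = y n" for n
    proof -
      have "part (piece n) (y m) = (if m = n then y n else 0)" for m
      proof (cases "m = n")
        case False
        then have "piece m \<inter> piece n = {}" using piece_disjoint by blast
        then have "keys (y m) \<inter> piece n = {}" using ysub[of m] by blast
        then show ?thesis using False by (simp add: part_eq_0)
      qed (simp add: part_eq_self ysub)
      then show ?thesis using fin y0 by (auto simp: p_def part_sum)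
    qed
    then have "fiber_class p = f" by (simp add: fiber_class_def fun_eq_iff fy)
    moreover have "keys p \<subseteq> fiber_monoid"
      unfolding p_def using ysub by (intro keys_sum_subset) blast
    ultimately show ?thesis by (intro image_eqI[of _ _ p]) simp_all
  qed
  ultimately show "bij_betw fiber_class (carrier ?A) (carrier ?F)"
    using \<open>\<And>p. p \<in> carrier ?A \<Longrightarrow> fiber_class p \<in> carrier ?F\<close> by (auto simp: bij_betw_def)
qed

theorem krull_dim_special_fiber_ring:
  "krull_dim (special_fiber_ring S \<mm> I) = krull_dim (monoid_algebra fiber_monoid :: ('v, 'k) mpolynomial ring)"
proof (rule krull_dim_ring_iso[OF cring_monoid_algebra[OF additive_submonoid_nfold_sums] fiber_class_iso])
  show "fiber_class \<zero>\<^bsub>monoid_algebra fiber_monoid\<^esub> = \<zero>\<^bsub>special_fiber_ring S \<mm> I\<^esub>"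
    using coset_zero by (simp add: fiber_class_def special_fiber_ring_def fun_eq_iff part_eq_0)
qed

end

end

section \<open>Complete split graphs\<close>

text \<open>The exponents of the edge monomials of the complete split graph, in which \<open>A\<close> is a clique, \<open>B\<close> is
  independent and every vertex of \<open>A\<close> is joined to every vertex of \<open>B\<close>.\<close>

definition complete_split_exps :: "'v set \<Rightarrow> 'v set \<Rightarrow> ('v \<Rightarrow>\<^sub>0 nat) set"
  where "complete_split_exps A B =
    {Poly_Mapping.single u 1 + Poly_Mapping.single v 1 | u v. u \<in> A \<and> v \<in> A \<union> B \<and> u \<noteq> v}"

abbreviation complete_split_monoid :: "'v set \<Rightarrow> 'v set \<Rightarrow> ('v \<Rightarrow>\<^sub>0 nat) set"
  where "complete_split_monoid A B \<equiv> \<Union>n. nfold_sums (complete_split_exps A B) n"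

lemma edge_exps_in_monoid:
  "u \<in> A \<Longrightarrow> v \<in> A \<union> B \<Longrightarrow> u \<noteq> v \<Longrightarrow>
    Poly_Mapping.single u 1 + Poly_Mapping.single v 1 \<in> complete_split_monoid A B"
  by (rule gens_in_nfold_sums) (auto simp: complete_split_exps_def)

context
  fixes A B :: "'v set"
  assumes fin: "finite A" "finite B" and disj: "A \<inter> B = {}"
begin

private abbreviation "M \<equiv> complete_split_monoid A B"

private abbreviation weight :: "'v set \<Rightarrow> ('v \<Rightarrow>\<^sub>0 nat) \<Rightarrow> nat"
  where "weight W t \<equiv> \<Sum>v\<in>W. lookup t v"

lemma weight_add: "weight W (s + t) = weight W s + weight W t"
  by (simp add: lookup_add sum.distrib)

lemma weight_single: "finite W \<Longrightarrow> weight W (Poly_Mapping.single v n) = (if v \<in> W then n else 0)"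
  by (simp add: lookup_single when_def)

lemma monoid_keys: "t \<in> M \<Longrightarrow> keys t \<subseteq> A \<union> B"
  by (induction t rule: nfold_sums_induct) (auto simp: complete_split_exps_def keys_add_nat)

lemma lookup_outside: "t \<in> M \<Longrightarrow> v \<notin> A \<union> B \<Longrightarrow> lookup t v = 0"
  using monoid_keys[of t] by (auto simp: in_keys_iff)

text \<open>Every edge has at least as many endpoints in the clique as outside it.  Equality holds
  precisely for products of edges between \<open>A\<close> and \<open>B\<close>.\<close>

lemma weight_B_le_A: "t \<in> M \<Longrightarrow> weight B t \<le> weight A t"
proof (induction t rule: nfold_sums_induct)
  case (add g t)
  then obtain u v where g: "g = Poly_Mapping.single u 1 + Poly_Mapping.single v 1" "u \<in> A" "v \<in> A \<union> B"
    by (auto simp: complete_split_exps_def)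
  then have "weight B g \<le> weight A g"
    unfolding g(1) weight_add using fin disj by (auto simp: weight_single)
  then show ?case using add.IH by (simp only: weight_add)
qed simp

text \<open>An edge at \<open>x\<close> has another endpoint different from \<open>x\<close>.\<close>

lemma lookup_le_rest: "t \<in> M \<Longrightarrow> lookup t x \<le> weight (A \<union> B - {x}) t"
proof (induction t rule: nfold_sums_induct)
  case (add g t)
  then obtain u v where g: "g = Poly_Mapping.single u 1 + Poly_Mapping.single v 1"
      "u \<in> A" "v \<in> A \<union> B" "u \<noteq> v"
    by (auto simp: complete_split_exps_def)
  then have "lookup g x \<le> weight (A \<union> B - {x}) g"
    unfolding g(1) weight_add using fin disj by (auto simp: weight_single lookup_add lookup_single when_def)
  then show ?case using add.IH by (subst weight_add) (simp add: lookup_add)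
qed simp

lemma star_balanced:
  assumes "t \<in> M" "x \<in> A" "keys t \<subseteq> insert x B"
  shows "weight B t = weight A t"
proof -
  have off: "lookup t v = 0" if "v \<in> A - {x}" for v
    using assms(3) that disj by (auto simp: in_keys_iff)
  have "weight A t = lookup t x + weight (A - {x}) t"
    using fin assms(2) by (simp add: sum.remove)
  also have "weight (A - {x}) t = 0" using off by simp
  finally have A: "weight A t = lookup t x" by simp
  have "A \<union> B - {x} = (A - {x}) \<union> B" using assms(2) disj by blast
  then have "weight (A \<union> B - {x}) t = weight (A - {x}) t + weight B t"
    using fin disj by (simp add: sum.union_disjoint Diff_Int_distrib2)
  then have "weight (A \<union> B - {x}) t = weight B t" using off by simp
  then show ?thesis using lookup_le_rest[OF assms(1), of x] weight_B_le_A[OF assms(1)] A by simp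
qed

lemma submonoid_M: "additive_submonoid M"
  by (rule additive_submonoid_nfold_sums)

text \<open>The products of edges of the star with centre \<open>x\<close> and the first \<open>j\<close> leaves.\<close>

definition star_face :: "'v \<Rightarrow> (nat \<Rightarrow> 'v) \<Rightarrow> nat \<Rightarrow> ('v \<Rightarrow>\<^sub>0 nat) set"
  where "star_face x y j = {t \<in> M. keys t \<subseteq> insert x (y ` {..<j})}"

lemma star_face_strict:
  assumes x: "x \<in> A" and y: "bij_betw y {..<b} B" and j: "j < b"
  shows "star_face x y j \<subset> star_face x y (Suc j)"
proof -
  have yj: "y j \<in> B" using y j by (auto simp: bij_betw_def)
  have "y i \<noteq> y j" if "i < j" for i
    using inj_onD[OF bij_betw_imp_inj_on[OF y], of i j] j that by auto
  then have "y j \<notin> y ` {..<j}" by force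
  moreover have "y j \<noteq> x" using yj x disj by blast
  ultimately have "Poly_Mapping.single x 1 + Poly_Mapping.single (y j) 1 \<in> star_face x y (Suc j) - star_face x y j"
    using edge_exps_in_monoid[of x A "y j" B] x yj by (auto simp: star_face_def keys_add_nat)
  moreover have "star_face x y j \<subseteq> star_face x y (Suc j)" by (force simp: star_face_def)
  ultimately show ?thesis by blast
qed

text \<open>In a star, the exponent of the centre is the sum of the exponents of the leaves, so the leaves
  determine an exponent; adding the leaves one by one gives a chain of faces of the same length.\<close>

lemma krull_dim_star:
  assumes "card A = 1"
  shows "krull_dim (monoid_algebra M :: ('v, 'k::field) mpolynomial ring) = enat (card B)"
proof (rule order_antisym)
  obtain x where A: "A = {x}" using assms by (rule card_1_singletonE)
  show "krull_dim (monoid_algebra M :: ('v, 'k) mpolynomial ring) \<le> enat (card B)"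
  proof (rule krull_dim_monoid_algebra_le[OF submonoid_M fin(2)])
    fix s t assume s: "s \<in> M" and t: "t \<in> M" and eq: "\<And>v. v \<in> B \<Longrightarrow> lookup s v = lookup t v"
    have "lookup r x = weight B r" if "r \<in> M" for r
      using star_balanced[OF that, of x] monoid_keys[OF that] A by simp
    then have "lookup s x = lookup t x" using s t eq by simp
    moreover have "lookup s v = lookup t v" if "v \<notin> A \<union> B" for v
      using s t that by (simp add: lookup_outside)
    ultimately have "lookup s v = lookup t v" for v
      using eq[of v] A by (cases "v \<in> B"; cases "v = x") auto
    then show "s = t" by (rule poly_mapping_eqI)
  qed
  obtain y where y: "bij_betw y {..<card B} B"
    using ex_bij_betw_nat_finite[OF fin(2)] by (auto simp: atLeast0LessThan)
  show "enat (card B) \<le> krull_dim (monoid_algebra M :: ('v, 'k) mpolynomial ring)"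
  proof (rule krull_dim_monoid_algebra_ge[OF submonoid_M, where F = "star_face x y"])
    show "face M (star_face x y j)" for j
      unfolding star_face_def by (rule face_support[OF submonoid_M])
    show "star_face x y j \<subset> star_face x y (Suc j)" if "j < card B" for j
      using star_face_strict[OF _ y that] A by simp
  qed
qed

text \<open>The chain of faces starts with the stars with centre \<open>x 0\<close> and an increasing set of leaves in
  \<open>B\<close>, and it ends with the monomials of the monoid in the variables \<open>x 0, \<dots>, x (k - 1)\<close> and \<open>B\<close>,
  for \<open>k \<ge> 2\<close>.  From the full star to \<open>k = 2\<close> the rank rises by two, because a new
  vertex is added and the graph acquires an odd cycle, a triangle through \<open>x 0\<close> and \<open>x 1\<close>.
  The face \<open>bal\<close>, the bipartite graph between \<open>{x 0, x 1}\<close> and \<open>B\<close>, is inserted there; it is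
  cut out from the face with \<open>k = 2\<close> by the inequality between the degrees in \<open>A\<close> and in \<open>B\<close>.\<close>

lemma krull_dim_complete_split:
  assumes A: "card A \<ge> 2" and B: "B \<noteq> {}"
  shows "krull_dim (monoid_algebra M :: ('v, 'k::field) mpolynomial ring) = enat (card A + card B)"
proof (rule order_antisym)
  have "krull_dim (monoid_algebra M :: ('v, 'k) mpolynomial ring) \<le> enat (card (A \<union> B))"
  proof (rule krull_dim_monoid_algebra_le[OF submonoid_M])
    fix s t assume s: "s \<in> M" and t: "t \<in> M" and eq: "\<And>v. v \<in> A \<union> B \<Longrightarrow> lookup s v = lookup t v"
    have "lookup s v = lookup t v" if "v \<notin> A \<union> B" for v
      using s t that by (simp add: lookup_outside)
    then show "s = t" using eq by (intro poly_mapping_eqI) blast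
  qed (use fin in simp)
  then show "krull_dim (monoid_algebra M :: ('v, 'k) mpolynomial ring) \<le> enat (card A + card B)"
    using fin disj by (simp add: card_Un_disjoint)
next
  define a b where "a = card A" and "b = card B"
  obtain x where x: "bij_betw x {..<a} A"
    using ex_bij_betw_nat_finite[OF fin(1)] by (auto simp: atLeast0LessThan a_def)
  obtain y where y: "bij_betw y {..<b} B"
    using ex_bij_betw_nat_finite[OF fin(2)] by (auto simp: atLeast0LessThan b_def)
  obtain z where z: "z \<in> B" using B by blast
  have xX: "x i \<in> A" if "i < a" for i using x that by (auto simp: bij_betw_def)
  have x_inj: "x i = x j \<longleftrightarrow> i = j" if "i < a" "j < a" for i j
    using x that by (auto simp: bij_betw_def inj_on_def)
  have xY: "x i \<notin> B" if "i < a" for i using xX[OF that] disj by blast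
  have yY: "y ` {..<b} = B" using y by (simp add: bij_betw_def)
  have a: "a \<ge> 2" using A by (simp add: a_def)
  define bal where "bal = {t \<in> M. keys t \<subseteq> x ` {..<2} \<union> B} \<inter> {t \<in> M. weight B t = weight A t}"
  define big where "big k = {t \<in> M. keys t \<subseteq> x ` {..<k} \<union> B}" for k
  define F where "F j = (if j \<le> b then star_face (x 0) y j else if j = Suc b then bal else big (j - b))" for j
  have face: "face M (F j)" for j
  proof -
    have "face M (star_face (x 0) y j)" "face M (big (j - b))"
      unfolding star_face_def big_def by (rule face_support[OF submonoid_M])+
    moreover have "face M bal"
      unfolding bal_def
      by (intro face_Int face_support submonoid_M face_tight weight_add weight_B_le_A)
    ultimately show ?thesis by (simp add: F_def)
  qed
  have edge_z: "Poly_Mapping.single (x i) 1 + Poly_Mapping.single z 1 \<in> M" if "i < a" for i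
    using edge_exps_in_monoid[of "x i" A z B] xX[OF that] xY[OF that] z by blast
  have strict: "F j \<subset> F (Suc j)" if j: "j < a + b" for j
  proof -
    consider "j < b" | "j = b" | "j = Suc b" | "j \<ge> b + 2" by linarith
    then show ?thesis
    proof cases
      case 1
      then show ?thesis using star_face_strict[OF _ y, of "x 0"] xX a by (simp add: F_def)
    next
      case 2
      have "weight B t = weight A t" if "t \<in> star_face (x 0) y b" for t
        using star_balanced[of t "x 0"] that xX[of 0] a by (simp add: star_face_def yY)
      then have "star_face (x 0) y b \<subseteq> bal"
        using yY by (auto simp: star_face_def bal_def)
      moreover have "weight B t = weight A t" if "t = Poly_Mapping.single (x 1) 1 + Poly_Mapping.single z 1" for t
        unfolding that weight_add using fin xX[of 1] xY[of 1] z disj a by (auto simp: weight_single)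
      then have "Poly_Mapping.single (x 1) 1 + Poly_Mapping.single z 1 \<in> bal - star_face (x 0) y b"
        using edge_z[of 1] a z x_inj[of 1 0] xY[of 1] by (auto simp: bal_def star_face_def yY keys_add_nat)
      ultimately show ?thesis using 2 by (auto simp: F_def)
    next
      case 3
      have "bal \<subseteq> big 2" by (auto simp: bal_def big_def)
      moreover have "weight B t \<noteq> weight A t" if "t = Poly_Mapping.single (x 0) 1 + Poly_Mapping.single (x 1) 1" for t
        unfolding that weight_add using fin xX[of 0] xX[of 1] xY[of 0] xY[of 1] a by (simp add: weight_single)
      then have "Poly_Mapping.single (x 0) 1 + Poly_Mapping.single (x 1) 1 \<in> big 2 - bal"
        using edge_exps_in_monoid[of "x 0" A "x 1" B] xX[of 0] xX[of 1] x_inj[of 0 1] a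
        by (auto simp: bal_def big_def keys_add_nat)
      ultimately show ?thesis using 3 by (auto simp: F_def numeral_2_eq_2)
    next
      case 4
      define k where "k = j - b"
      have k: "j = b + k" "2 \<le> k" "k < a" using 4 j by (simp_all add: k_def)
      have "x k \<notin> x ` {..<k}" using x_inj k(3) by auto
      then have "Poly_Mapping.single (x k) 1 + Poly_Mapping.single z 1 \<in> big (Suc k) - big k"
        using edge_z[of k] z xY[of k] k(3) by (auto simp: big_def keys_add_nat)
      moreover have "big k \<subseteq> big (Suc k)" by (force simp: big_def)
      moreover have "F j = big k" "F (Suc j) = big (Suc k)" using k by (simp_all add: F_def)
      ultimately show ?thesis by blast
    qed
  qed
  show "enat (card A + card B) \<le> krull_dim (monoid_algebra M :: ('v, 'k) mpolynomial ring)"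
    unfolding a_def[symmetric] b_def[symmetric]
    by (rule krull_dim_monoid_algebra_ge[OF submonoid_M, where F = F, OF face strict])
qed

end

section \<open>Prime ideal graphs\<close>

lemma analytic_spread_edge_ideal:
  fixes V :: "'v set" and E :: "'v set set"
  defines "G \<equiv> {Poly_Mapping.single u (1::nat) + Poly_Mapping.single v 1 | u v. {u, v} \<in> E}"
  assumes "\<Union>E \<subseteq> V"
  shows "analytic_spread V (edge_ideal V E :: ('v, 'k::field) mpolynomial set) =
    krull_dim (monoid_algebra (\<Union>n. nfold_sums G n) :: ('v, 'k) mpolynomial ring)"
proof -
  have "u \<in> V" "v \<in> V" if "{u, v} \<in> E" for u v using that assms(2) by blast+
  then interpret equigenerated V G 2
    by unfold_locales (auto simp: G_def keys_add_nat total_degree_add)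
  have "{mvar u * mvar v | u v. {u, v} \<in> E} = (\<lambda>t. Poly_Mapping.single t (1 :: 'k)) ` G"
    by (force simp: G_def mvar_def mult_single)
  then show ?thesis
    unfolding analytic_spread_def edge_ideal_def
    by (intro krull_dim_special_fiber_ring) simp
qed

text \<open>As \<open>P\<close> is prime, two vertices are adjacent iff one of them lies in \<open>P\<close>.  The graph is
  therefore the complete split graph with clique \<open>P - {0}\<close> and independent set \<open>R - P\<close>; for \<open>card P = 2\<close> it is a star.\<close>

theorem analytic_spread_prime_ideal_graph:
  fixes R :: "('r, 'm) ring_scheme" and P :: "'r set"
  defines "V \<equiv> prime_ideal_graph_verts R"
  defines "I \<equiv> edge_ideal V (prime_ideal_graph_edges R P) :: ('r, 'k::field) mpolynomial set"
  assumes P: "primeideal P R" and fin: "finite (carrier R)" 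
  shows "card P = 2 \<Longrightarrow> analytic_spread V I = enat (card (carrier R) - 2)"
    and "card P \<ge> 3 \<Longrightarrow> analytic_spread V I = enat (card (carrier R) - 1)"
proof -
  interpret primeideal P R by (rule P)
  define A where "A = P - {\<zero>\<^bsub>R\<^esub>}"
  define B where "B = carrier R - P"
  have PR: "P \<subseteq> carrier R" by (rule a_subset)
  have zero: "\<zero>\<^bsub>R\<^esub> \<in> P" by (rule additive_subgroup.zero_closed[OF additive_subgroup_axioms])
  have AB: "finite A" "finite B" "A \<inter> B = {}" "A \<union> B = V"
    using fin PR zero finite_subset[OF PR fin] by (auto simp: A_def B_def V_def prime_ideal_graph_verts_def)
  have "B \<noteq> {}" using PR I_notcarr by (auto simp: B_def)
  have edge_iff: "{u, v} \<in> prime_ideal_graph_edges R P \<longleftrightarrow> u \<in> V \<and> v \<in> V \<and> u \<noteq> v \<and> (u \<in> P \<or> v \<in> P)" for u v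
  proof -
    have "u \<otimes>\<^bsub>R\<^esub> v \<in> P \<longleftrightarrow> u \<in> P \<or> v \<in> P" if "u \<in> carrier R" "v \<in> carrier R" for u v
      using I_prime I_l_closed I_r_closed that by blast
    then have "{u, v} \<in> prime_ideal_graph_edges R P \<longleftrightarrow>
        (\<exists>x y. {u, v} = {x, y} \<and> x \<in> V \<and> y \<in> V \<and> x \<noteq> y \<and> (x \<in> P \<or> y \<in> P))"
      unfolding prime_ideal_graph_edges_def V_def prime_ideal_graph_verts_def by blast
    then show ?thesis by (auto simp: doubleton_eq_iff)
  qed
  have "{Poly_Mapping.single u (1::nat) + Poly_Mapping.single v 1 | u v. {u, v} \<in> prime_ideal_graph_edges R P} =
      complete_split_exps A B" (is "?L = ?R")
  proof
    show "?R \<subseteq> ?L"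
      using AB(4) by (fastforce simp: complete_split_exps_def edge_iff A_def)
    show "?L \<subseteq> ?R"
    proof
      fix t assume "t \<in> ?L"
      then obtain u v where t: "t = Poly_Mapping.single u 1 + Poly_Mapping.single v 1"
          "u \<in> V" "v \<in> V" "u \<noteq> v" "u \<in> P \<or> v \<in> P"
        by (auto simp: edge_iff)
      then have "u \<in> A \<or> v \<in> A" by (auto simp: A_def V_def prime_ideal_graph_verts_def)
      then show "t \<in> ?R"
        unfolding complete_split_exps_def AB(4) using t add.commute by blast
    qed
  qed
  then have spread: "analytic_spread V I = krull_dim (monoid_algebra (complete_split_monoid A B) :: ('r, 'k) mpolynomial ring)"
    unfolding I_def using analytic_spread_edge_ideal[of "prime_ideal_graph_edges R P" V]
    by (auto simp: V_def prime_ideal_graph_edges_def)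
  have cX: "card A = card P - 1" unfolding A_def using zero by simp
  have cY: "card B = card (carrier R) - card P"
    unfolding B_def using PR fin by (simp add: card_Diff_subset finite_subset)
  have le: "card P \<le> card (carrier R)" using PR fin by (rule card_mono[rotated])
  show "analytic_spread V I = enat (card (carrier R) - 2)" if "card P = 2"
    using krull_dim_star[OF AB(1-3)] that unfolding spread cX cY by simp
  show "analytic_spread V I = enat (card (carrier R) - 1)" if "card P \<ge> 3"
  proof -
    have "card A \<ge> 2" using that cX by simp
    then show ?thesis
      using krull_dim_complete_split[OF AB(1-3) _ \<open>B \<noteq> {}\<close>, where 'k = 'k] that le cX cY spread by simp
  qed
qed

theorem theorem5p2:
  fixes R :: "('r, 'm) ring_scheme"
    and P :: "'r set"
    and a b :: nat
    and I :: "('r, 'k::field) mpolynomial set"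
  assumes "cring R" and "finite (carrier R)"
    and "primeideal P R" and "card P \<ge> 2"
    and "a = card P - 1"
    and "b = card P * (card (carrier (R Quot P)) - 1)"
    and "I = edge_ideal (prime_ideal_graph_verts R) (prime_ideal_graph_edges R P)"
  shows "((a = 1 \<longrightarrow> analytic_spread (prime_ideal_graph_verts R) I = enat b) \<and>
          (a \<ge> 2 \<longrightarrow> analytic_spread (prime_ideal_graph_verts R) I = enat (a + b))) \<and>
         ((card P = 2 \<longrightarrow> analytic_spread (prime_ideal_graph_verts R) I = enat (card (carrier R) - 2)) \<and>
          (card P \<ge> 3 \<longrightarrow> analytic_spread (prime_ideal_graph_verts R) I = enat (card (carrier R) - 1))) \<and>
         ((card P = 2 \<longrightarrow> analytic_spread (prime_ideal_graph_verts R) I = enat (2 * (card (carrier (R Quot P)) - 1))) \<and>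
          (card P \<ge> 3 \<longrightarrow> analytic_spread (prime_ideal_graph_verts R) I = enat (card P * card (carrier (R Quot P)) - 1)))"
proof -
  interpret primeideal P R by fact
  have lagrange: "card P * card (carrier (R Quot P)) = card (carrier R)"
    using abelian_group.a_lagrange[OF is_abelian_group \<open>finite (carrier R)\<close> additive_subgroup_axioms]
    by (simp add: FactRing_def order_def mult.commute)
  have "card (carrier R) > 0" using \<open>finite (carrier R)\<close> by (auto simp: card_gt_0_iff)
  then have "card (carrier (R Quot P)) > 0" using lagrange by (metis mult_0_right neq0_conv)
  then have b: "b + card P = card (carrier R)"
    unfolding \<open>b = _\<close> lagrange[symmetric] by (simp add: right_diff_distrib')
  have "a + b = card (carrier R) - 1" using b \<open>a = _\<close> \<open>card P \<ge> 2\<close> by simp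
  moreover have "a = 1 \<longleftrightarrow> card P = 2" "a \<ge> 2 \<longleftrightarrow> card P \<ge> 3"
    using \<open>a = _\<close> \<open>card P \<ge> 2\<close> by auto
  moreover have "b = card (carrier R) - 2" "b = 2 * (card (carrier (R Quot P)) - 1)" if "card P = 2"
    using b that \<open>b = _\<close> by simp_all
  ultimately show ?thesis
    using analytic_spread_prime_ideal_graph[OF \<open>primeideal P R\<close> \<open>finite (carrier R)\<close>, where 'k = 'k] lagrange
    unfolding \<open>I = _\<close> by simp
qed

end
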